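(* Let $\omega:\mathcal A\to\mathcal A^+$ be an admissible tile substitution in $\mathbb R^d$ with expansion $\varphi$, satisfying FPC, and let $(X_{\mathcal A,\omega},\mathbb R^d)$ be the associated tiling dynamical system. Then every ergodic invariant Borel probability measure $\mu$ of $(X_{\mathcal A,\omega},\mathbb R^d)$ is supported on the minimal components, i.e. the union of all minimal components of $(X_{\mathcal A,\omega},\mathbb R^d)$ has full $\mu$-measure.
   Context: A tile in $\mathbb R^d$ is a pair $T=(F,i)$ where $F=\operatorname{supp}(T)$ is a (nonempty) compact set that is the closure of its interior and $i$ is a label (type) from a finite set; $T+g=(F+g,i)$. A tiling is a set of tiles whose supports have union $\mathbb R^d$ and such that distinct tiles have supports with disjoint interiors. A patch is a finite set of tiles with pairwise disjoint interiors; $\operatorname{supp}(P)$ is the union of the supports of its tiles. $\mathcal A=\{A_1,\dots,A_N\}$ is a finite set of pairwise translationally inequivalent tiles (prototiles), each with $0\in\operatorname{int}(\operatorname{supp}(A_j))$; $\mathcal A^+$ is the set of patches all of whose tiles are translates of prototiles. Let $\varphi:\mathbb R^d\to\mathbb R^d$ be an expansive linear map (all eigenvalues have modulus $>1$). A tile substitution with expansion $\varphi$ is a map $\omega:\mathcal A\to\mathcal A^+$ with $\operatorname{supp}(\omega(A_j))=\varphi(\operatorname{supp}(A_j))$ for all $j$; it is extended by $\omega(x+A_j)=\varphi(x)+\omega(A_j)$ to translates of prototiles, and tile by tile to patches and tilings. A patch $P$ is legal if $P+x\subseteq\omega^n(A_j)$ for some $n\ge1$, $j$, $x\in\mathbb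 R^d$. $X_{\mathcal A,\omega}$ is the set of all tilings of $\mathbb R^d$ all of whose patches (finite subsets) are legal. $\omega$ is admissible if every prototile $A_j$ is a tile of some $\mathcal T\in X_{\mathcal A,\omega}$. FPC (finite pattern condition): for every $R>0$ there are, up to translation, finitely many patches of diameter less than $R$ occurring in tilings of $X_{\mathcal A,\omega}$. $X_{\mathcal A,\omega}$ carries the metric $\varrho(\mathcal T_1,\mathcal T_2)=\min\{2^{-1/2},\inf\{r\in(0,2^{-1/2}):\exists g,\ \|g\|\le r,\ \operatorname{supp}((\mathcal T_1-g)\cap\mathcal T_2)\supseteq B_{1/r}(0)\}\}$, and $\mathbb R^d$ acts continuously by translations $\mathcal T\mapsto\mathcal T-g$. A minimal component is a nonempty closed translation-invariant subset of $X_{\mathcal A,\omega}$ on which every orbit is dense. A measure is invariant if it is invariant under all translations. *)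

theory Defs
  imports "HOL-Probability.Probability_Measure"
begin

section \<open>Tiles, patches, tilings\<close>

type_synonym ('n, 'l) tile = "(real ^ 'n) set \<times> 'l"

abbreviation supp :: "('n::finite, 'l) tile \<Rightarrow> (real ^ 'n) set" where
  "supp T \<equiv> fst T"

definition is_tile :: "('n::finite, 'l) tile \<Rightarrow> bool" where
  "is_tile T \<longleftrightarrow> supp T \<noteq> {} \<and> compact (supp T) \<and> closure (interior (supp T)) = supp T"

definition tile_shift :: "real ^ 'n \<Rightarrow> ('n::finite, 'l) tile \<Rightarrow> ('n, 'l) tile" where
  "tile_shift g T = ((+) g ` fst T, snd T)"

abbreviation shift :: "real ^ 'n \<Rightarrow> ('n::finite, 'l) tile set \<Rightarrow> ('n, 'l) tile set" where
  "shift g P \<equiv> tile_shift g ` P"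

definition set_supp :: "('n::finite, 'l) tile set \<Rightarrow> (real ^ 'n) set" where
  "set_supp P = (\<Union>T\<in>P. supp T)"

definition nonoverlapping :: "('n::finite, 'l) tile set \<Rightarrow> bool" where
  "nonoverlapping P \<longleftrightarrow> pairwise (\<lambda>S T. interior (supp S) \<inter> interior (supp T) = {}) P"

definition is_tiling :: "('n::finite, 'l) tile set \<Rightarrow> bool" where
  "is_tiling \<T> \<longleftrightarrow> (\<forall>T\<in>\<T>. is_tile T) \<and> set_supp \<T> = UNIV \<and> nonoverlapping \<T>"

definition is_patch :: "('n::finite, 'l) tile set \<Rightarrow> bool" where
  "is_patch P \<longleftrightarrow> finite P \<and> (\<forall>T\<in>P. is_tile T) \<and> nonoverlapping P"

definition is_prototile_set :: "('n::finite, 'l) tile set \<Rightarrow> bool" where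
  "is_prototile_set \<A> \<longleftrightarrow> finite \<A> \<and>
     (\<forall>A\<in>\<A>. is_tile A \<and> 0 \<in> interior (supp A)) \<and>
     (\<forall>A\<in>\<A>. \<forall>B\<in>\<A>. \<forall>x. B = tile_shift x A \<longrightarrow> A = B)"

definition patches_over :: "('n::finite, 'l) tile set \<Rightarrow> ('n, 'l) tile set set" where
  "patches_over \<A> = {P. is_patch P \<and> (\<forall>T\<in>P. \<exists>A\<in>\<A>. \<exists>x. T = tile_shift x A)}"


section \<open>Tile substitutions\<close>

text \<open>Eigenvalues are complex, i.e. those of the matrix of \<open>\<phi>\<close> acting on \<open>complex ^ 'n\<close>.\<close>

definition expansive_linear :: "(real ^ 'n \<Rightarrow> real ^ 'n::finite) \<Rightarrow> bool" where
  "expansive_linear \<phi> \<longleftrightarrow> linear \<phi> \<and>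
     (\<forall>(z::complex) (v::complex ^ 'n).
        v \<noteq> 0 \<and> map_matrix complex_of_real (matrix \<phi>) *v v = z *s v \<longrightarrow> cmod z > 1)"

text \<open>Only the values of \<open>\<omega>\<close> on \<open>\<A>\<close> are relevant.\<close>

definition tile_substitution ::
  "(real ^ 'n \<Rightarrow> real ^ 'n) \<Rightarrow> ('n::finite, 'l) tile set \<Rightarrow> (('n, 'l) tile \<Rightarrow> ('n, 'l) tile set) \<Rightarrow> bool"
where
  "tile_substitution \<phi> \<A> \<omega> \<longleftrightarrow> is_prototile_set \<A> \<and> expansive_linear \<phi> \<and>
     (\<forall>A\<in>\<A>. \<omega> A \<in> patches_over \<A> \<and> set_supp (\<omega> A) = \<phi> ` supp A)"

text \<open>
  Extension of \<open>\<omega>\<close> to sets of translates of prototiles.  For a prototile set the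
  representation of a tile as \<open>tile_shift x A\<close> is unique, which gives the lemma
  \<open>subst_set_tile\<close> below.
\<close>

definition subst_set ::
  "(real ^ 'n \<Rightarrow> real ^ 'n) \<Rightarrow> ('n::finite, 'l) tile set \<Rightarrow> (('n, 'l) tile \<Rightarrow> ('n, 'l) tile set)
     \<Rightarrow> ('n, 'l) tile set \<Rightarrow> ('n, 'l) tile set"
where
  "subst_set \<phi> \<A> \<omega> P = \<Union>{shift (\<phi> x) (\<omega> A) | x A. A \<in> \<A> \<and> tile_shift x A \<in> P}"

definition legal ::
  "(real ^ 'n \<Rightarrow> real ^ 'n) \<Rightarrow> ('n::finite, 'l) tile set \<Rightarrow> (('n, 'l) tile \<Rightarrow> ('n, 'l) tile set)
     \<Rightarrow> ('n, 'l) tile set \<Rightarrow> bool"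
where
  "legal \<phi> \<A> \<omega> P \<longleftrightarrow> is_patch P \<and>
     (\<exists>n\<ge>1. \<exists>A\<in>\<A>. \<exists>x. shift x P \<subseteq> (subst_set \<phi> \<A> \<omega> ^^ n) {A})"

definition tiling_space ::
  "(real ^ 'n \<Rightarrow> real ^ 'n) \<Rightarrow> ('n::finite, 'l) tile set \<Rightarrow> (('n, 'l) tile \<Rightarrow> ('n, 'l) tile set)
     \<Rightarrow> ('n, 'l) tile set set"
where
  "tiling_space \<phi> \<A> \<omega> =
     {\<T>. is_tiling \<T> \<and> (\<forall>P. P \<subseteq> \<T> \<and> finite P \<longrightarrow> legal \<phi> \<A> \<omega> P)}"

definition admissible ::
  "(real ^ 'n \<Rightarrow> real ^ 'n) \<Rightarrow> ('n::finite, 'l) tile set \<Rightarrow> (('n, 'l) tile \<Rightarrow> ('n, 'l) tile set) \<Rightarrow> bool"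
where
  "admissible \<phi> \<A> \<omega> \<longleftrightarrow> (\<forall>A\<in>\<A>. \<exists>\<T>\<in>tiling_space \<phi> \<A> \<omega>. A \<in> \<T>)"

definition translation_equiv :: "(('n::finite, 'l) tile set \<times> ('n, 'l) tile set) set" where
  "translation_equiv = {(P, Q). \<exists>x. Q = shift x P}"

definition FPC :: "('n::finite, 'l) tile set set \<Rightarrow> bool" where
  "FPC X \<longleftrightarrow> (\<forall>R>0. finite
     ({P. finite P \<and> (\<exists>\<T>\<in>X. P \<subseteq> \<T>) \<and> diameter (set_supp P) < R} // translation_equiv))"


section \<open>The tiling dynamical system\<close>

text \<open>The infimum of the empty set counts as \<open>+\<infinity>\<close>, so the distance is then \<open>2 powr (-1/2)\<close>.\<close>

definition tiling_dist :: "('n::finite, 'l) tile set \<Rightarrow> ('n, 'l) tile set \<Rightarrow> real" where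
  "tiling_dist \<T>\<^sub>1 \<T>\<^sub>2 =
     (let c = 2 powr (-1/2);
          D = {r. 0 < r \<and> r < c \<and>
                (\<exists>g. norm g \<le> r \<and> ball 0 (1 / r) \<subseteq> set_supp (shift (- g) \<T>\<^sub>1 \<inter> \<T>\<^sub>2))}
      in if D = {} then c else min c (Inf D))"

text \<open>
  The topology generated by \<open>tiling_dist\<close>.  The construction of \<open>Metric_space.mtopology\<close> is
  repeated here because the locale assumes exact symmetry, whereas the formula for
  \<open>tiling_dist\<close> only shifts its first argument.  Exchanging the arguments gives an equivalent
  distance (agreement of \<open>\<T>\<^sub>1 - g\<close> and \<open>\<T>\<^sub>2\<close> on the ball of radius \<open>1/r\<close> about \<open>0\<close> implies agreement
  of \<open>\<T>\<^sub>2 + g\<close> and \<open>\<T>\<^sub>1\<close> on the ball of radius \<open>1/r - r\<close>), hence the same topology.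
\<close>

definition tiling_topology :: "('n::finite, 'l) tile set set \<Rightarrow> ('n, 'l) tile set topology" where
  "tiling_topology X = topology (\<lambda>U. U \<subseteq> X \<and>
     (\<forall>\<T>\<in>U. \<exists>\<epsilon>>0. {\<S>\<in>X. tiling_dist \<T> \<S> < \<epsilon>} \<subseteq> U))"

definition tiling_borel :: "('n::finite, 'l) tile set set \<Rightarrow> ('n, 'l) tile set measure" where
  "tiling_borel X = sigma X {U. openin (tiling_topology X) U}"

definition orbit :: "('n::finite, 'l) tile set \<Rightarrow> ('n, 'l) tile set set" where
  "orbit \<T> = range (\<lambda>g. shift (- g) \<T>)"

definition minimal_component ::
  "('n::finite, 'l) tile set set \<Rightarrow> ('n, 'l) tile set set \<Rightarrow> bool"
where
  "minimal_component X Y \<longleftrightarrow> Y \<noteq> {} \<and> closedin (tiling_topology X) Y \<and>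
     (\<forall>\<T>\<in>Y. \<forall>g. shift (- g) \<T> \<in> Y) \<and>
     (\<forall>\<T>\<in>Y. subtopology (tiling_topology X) Y closure_of orbit \<T> = Y)"

definition translation_invariant :: "('n::finite, 'l) tile set measure \<Rightarrow> bool" where
  "translation_invariant \<mu> \<longleftrightarrow>
     (\<forall>g. \<forall>B\<in>sets \<mu>. emeasure \<mu> ((\<lambda>\<T>. shift (- g) \<T>) ` B) = emeasure \<mu> B)"

definition translation_ergodic :: "('n::finite, 'l) tile set measure \<Rightarrow> bool" where
  "translation_ergodic \<mu> \<longleftrightarrow>
     (\<forall>B\<in>sets \<mu>. (\<forall>g. (\<lambda>\<T>. shift (- g) \<T>) ` B = B) \<longrightarrow> emeasure \<mu> B = 0 \<or> emeasure \<mu> B = 1)"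


section \<open>Consistency of the definitions\<close>

lemma openin_tiling_topology:
  "openin (tiling_topology X) U \<longleftrightarrow>
     U \<subseteq> X \<and> (\<forall>\<T>\<in>U. \<exists>\<epsilon>>0. {\<S>\<in>X. tiling_dist \<T> \<S> < \<epsilon>} \<subseteq> U)"
proof -
  let ?O = "\<lambda>U. U \<subseteq> X \<and> (\<forall>\<T>\<in>U. \<exists>\<epsilon>>0. {\<S>\<in>X. tiling_dist \<T> \<S> < \<epsilon>} \<subseteq> U)"
  have "?O (S \<inter> T)" if S: "?O S" and T: "?O T" for S T
  proof (intro conjI ballI)
    show "S \<inter> T \<subseteq> X" using S by blast
    fix \<T> assume "\<T> \<in> S \<inter> T"
    then obtain d e where "d > 0" "{\<S>\<in>X. tiling_dist \<T> \<S> < d} \<subseteq> S"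
      and "e > 0" "{\<S>\<in>X. tiling_dist \<T> \<S> < e} \<subseteq> T"
      using S T by blast
    then show "\<exists>\<epsilon>>0. {\<S>\<in>X. tiling_dist \<T> \<S> < \<epsilon>} \<subseteq> S \<inter> T"
      by (intro exI[of _ "min d e"]) auto
  qed
  moreover have "?O (\<Union>\<K>)" if K: "\<forall>K\<in>\<K>. ?O K" for \<K>
  proof (intro conjI ballI)
    show "\<Union>\<K> \<subseteq> X" using K by blast
    fix \<T> assume "\<T> \<in> \<Union>\<K>"
    then obtain K where "K \<in> \<K>" "\<T> \<in> K" by blast
    then obtain e where "e > 0" "{\<S>\<in>X. tiling_dist \<T> \<S> < e} \<subseteq> K"
      using K by blast
    with \<open>K \<in> \<K>\<close> show "\<exists>\<epsilon>>0. {\<S>\<in>X. tiling_dist \<T> \<S> < \<epsilon>} \<subseteq> \<Union>\<K>" by blast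
  qed
  ultimately have "istopology ?O"
    unfolding istopology_def by blast
  then show ?thesis
    by (simp add: tiling_topology_def topology_inverse')
qed

lemma topspace_tiling_topology [simp]: "topspace (tiling_topology X) = X"
proof
  show "topspace (tiling_topology X) \<subseteq> X"
    using openin_tiling_topology openin_topspace by blast
  have "openin (tiling_topology X) X"
    unfolding openin_tiling_topology using zero_less_one by blast
  then show "X \<subseteq> topspace (tiling_topology X)"
    by (rule openin_subset)
qed

lemma tile_shift_add: "tile_shift x (tile_shift y T) = tile_shift (x + y) T"
  by (simp add: tile_shift_def image_image add.assoc)

lemma tile_shift_0 [simp]: "tile_shift 0 T = T"
  by (simp add: tile_shift_def)

lemma tile_shift_fixed:
  assumes "is_tile T" and "tile_shift z T = T"
  shows "z = 0"
proof -
  have "compact (supp T)" "supp T \<noteq> {}"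
    using assms(1) by (auto simp: is_tile_def)
  then obtain p where p: "p \<in> supp T" "\<forall>y\<in>supp T. y \<bullet> z \<le> p \<bullet> z"
    using continuous_attains_sup[of "supp T" "\<lambda>y. y \<bullet> z"]
      continuous_on_inner[OF continuous_on_id continuous_on_const, of "supp T" z]
    by blast
  have "(+) z ` supp T = supp T"
    using arg_cong[OF assms(2), of fst] by (simp add: tile_shift_def)
  then have "z + p \<in> supp T" using p(1) by blast
  with p(2) have "(z + p) \<bullet> z \<le> p \<bullet> z" by blast
  then have "z \<bullet> z \<le> 0" by (simp add: inner_add_left)
  then show "z = 0" using inner_gt_zero_iff[of z] by linarith
qed

lemma subst_set_tile:
  assumes "is_prototile_set \<A>" and "A \<in> \<A>"
  shows "subst_set \<phi> \<A> \<omega> {tile_shift x A} = shift (\<phi> x) (\<omega> A)"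
proof -
  have "y = x \<and> B = A" if "B \<in> \<A>" and eq: "tile_shift y B = tile_shift x A" for y B
  proof -
    have "tile_shift (- x + y) B = A"
      using arg_cong[OF eq, of "tile_shift (- x)"] by (simp add: tile_shift_add)
    moreover from this have "B = A"
      using assms that(1) unfolding is_prototile_set_def by metis
    ultimately show ?thesis
      using tile_shift_fixed[of A "- x + y"] assms unfolding is_prototile_set_def by auto
  qed
  then have "{shift (\<phi> y) (\<omega> B) | y B. B \<in> \<A> \<and> tile_shift y B \<in> {tile_shift x A}}
      = {shift (\<phi> x) (\<omega> A)}"
    using assms(2) by blast
  then show ?thesis unfolding subst_set_def by simp
qed

lemma subst_set_Union: "subst_set \<phi> \<A> \<omega> P = (\<Union>T\<in>P. subst_set \<phi> \<A> \<omega> {T})"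
  unfolding subst_set_def by blast

end

theory Submission
  imports Defs "HOL-Computational_Algebra.Fundamental_Theorem_Algebra"
begin

text \<open>
  For a suitable period \<open>p\<close>, call a prototile \<open>D\<close> final if every prototile occurring in \<open>\<omega>\<^sup>p(D)\<close>
  produces \<open>D\<close> again under \<open>\<omega>\<^sup>p\<close>; every prototile produces a final one.  The minimal components are
  exactly the sets of tilings whose patches all occur in some \<open>\<omega>\<^sup>n(D)\<close>, \<open>p dvd n\<close>, for a fixed final \<open>D\<close>.

  A tiling outside all of these contains, in some ball of radius \<open>R\<close>, a bad patch, one that occurs in no
  \<open>\<omega>\<^sup>n(D)\<close>.  No bad patch lies well inside a supertile of final type.  In a supertile of high level, descend
  through the hierarchy: at each stage a fixed proportion of the volume lies deep inside a subsupertile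
  of final type, and after further inflation such points are far from the boundary.  So the part that
  can be close to bad patches has relative volume at most \<open>const * \<theta> ^ k\<close> with \<open>\<theta> < 1\<close>, for all \<open>k\<close>.
  Counting the integer translates of a tiling that see a bad patch within distance \<open>R\<close> of the origin, and
  integrating against the invariant measure, shows that this event has measure zero.
\<close>

section \<open>Powers of expansive maps\<close>

text \<open>Translates are counted on one finite cube, so a hierarchy is needed only there: legality
  places a large patch of the tiling inside a single \<open>infl N {A}\<close>, and the levels of
  that supertile are used. No tiling is ever desubstituted. No norm adapted to \<open>\<phi>\<close>
  is chosen, so expansion is available only for large powers, and supertile boundaries may be
  irregular. Hence depth is first measured with the fixed margin 1, and \<open>K\<close> further
  inflations turn that margin into a prescribed radius. The order of choices matters. The constants
  \<kappa> and \<theta> depend only on the substitution; then \<open>R\<close> and \<open>k\<close>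
  are given, \<open>K\<close> is chosen from \<open>R\<close>, and the side \<open>L\<close> of the
  cube from all of these. This is why \<open>k\<close> may tend to infinity while \<open>R\<close>
  stays fixed.\<close>

lemma tendsto_zero_recurrence:
  fixes a b :: "nat \<Rightarrow> real"
  assumes c: "0 \<le> c" "c < 1" and a: "\<And>n. 0 \<le> a n" and b: "b \<longlonglongrightarrow> 0"
    and rec: "\<And>n. a (Suc n) \<le> c * a n + b n"
  shows "a \<longlonglongrightarrow> 0"
proof (rule LIMSEQ_I)
  fix r :: real assume "r > 0"
  \<comment> \<open>With this \<open>e\<close>, \<open>r / 2\<close> is the fixed point of t -> c *
    t + e, so the recurrence preserves a remainder of \<open>r / 2\<close>.\<close>
  define e where "e = r * (1 - c) / 2"
  have "e > 0" using c \<open>r > 0\<close> by (simp add: e_def)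
  then obtain N where N: "\<And>n. n \<ge> N \<Longrightarrow> b n < e"
    using LIMSEQ_D[OF b \<open>e > 0\<close>] by (auto simp: abs_less_iff)
  have bd: "a (N + k) \<le> c ^ k * a N + r / 2" for k
  proof (induction k)
    case 0 then show ?case using \<open>r > 0\<close> by simp
  next
    case (Suc k)
    have "a (N + Suc k) \<le> c * a (N + k) + b (N + k)" using rec by simp
    also have "\<dots> \<le> c * (c ^ k * a N + r / 2) + e"
      using Suc N[of "N + k"] c by (intro add_mono mult_left_mono) auto
    also have "\<dots> = c ^ Suc k * a N + r / 2"
      by (simp add: e_def field_simps)
    finally show ?case .
  qed
  have "(\<lambda>k. c ^ k * a N) \<longlonglongrightarrow> 0"
    using c by (intro tendsto_mult_left_zero LIMSEQ_power_zero) auto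
  from LIMSEQ_D[OF this, of "r / 2"] \<open>r > 0\<close>
  obtain K where K: "\<And>k. k \<ge> K \<Longrightarrow> \<bar>c ^ k * a N\<bar> < r / 2" by auto
  show "\<exists>no. \<forall>n\<ge>no. norm (a n - 0) < r"
  proof (intro exI allI impI)
    fix n assume "n \<ge> N + K"
    then have "a n < r" using bd[of "n - N"] K[of "n - N"] by auto linarith
    then show "norm (a n - 0) < r" using a[of n] by simp
  qed
qed

text \<open>This is q(N) v in Horner form, computed on the vector so that no polynomial in the
  matrix has to be formed.\<close>

definition poly_vec :: "complex ^ 'n ^ 'n \<Rightarrow> complex poly \<Rightarrow> complex ^ 'n \<Rightarrow> complex ^ 'n::finite" where
  "poly_vec N q v = fold_coeffs (\<lambda>a w. a *s v + N *v w) q 0"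

lemma poly_vec_0 [simp]: "poly_vec N 0 v = 0"
  by (simp add: poly_vec_def)

lemma poly_vec_pCons [simp]: "poly_vec N (pCons a q) v = a *s v + N *v poly_vec N q v"
  by (cases "q = 0 \<and> a = 0") (auto simp: poly_vec_def)

lemma poly_vec_add: "poly_vec N (p + q) v = poly_vec N p v + poly_vec N q v"
  by (induction p q rule: poly_induct2)
    (auto simp: matrix_vector_right_distrib vector_sadd_rdistrib)

lemma poly_vec_smult: "poly_vec N (smult c p) v = c *s poly_vec N p v"
  by (induction p) (auto simp: vec.scale_right_distrib matrix_vector_mult_scaleR vector_scalar_commute)

lemma poly_vec_sum: "poly_vec N (sum f I) v = (\<Sum>i\<in>I. poly_vec N (f i) v)"
  by (induction I rule: infinite_finite_induct) (auto simp: poly_vec_add)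

lemma poly_vec_monom: "poly_vec N (monom c i) v = c *s (((*v) N ^^ i) v)"
  by (induction i) (auto simp: monom_0 monom_Suc vector_scalar_commute)

lemma poly_vec_linear_factor:
  "poly_vec N ([:- z, 1:] * q) v = N *v poly_vec N q v - z *s poly_vec N q v"
proof -
  have "[:- z, 1:] * q = smult (- z) q + pCons 0 q" by simp
  then show ?thesis by (simp only: poly_vec_add poly_vec_smult) simp
qed

text \<open>If (t - z) r annihilates \<open>v\<close>, this shows that r, of smaller degree,
  annihilates \<open>N v - z v\<close>; an induction on the degree rests on it.\<close>

lemma poly_vec_commute:
  "poly_vec N q (N *v v - z *s v) = N *v poly_vec N q v - z *s poly_vec N q v"
proof (induction q)
  case (pCons a q)
  then show ?case
    by (simp only: poly_vec_pCons)
      (simp add: algebra_simps vector_scalar_commute matrix_vector_right_distrib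
        matrix_vector_mult_diff_distrib vec.scale_right_distrib vec.scale_right_diff_distrib mult.commute)
qed simp

text \<open>With d the dimension, the d + 1 vectors v, N v, ..., N^d v are dependent. Repetitions
  would be lost in the set to which dependence is applied, so they are treated separately.\<close>

lemma ex_annihilating_poly:
  fixes N :: "complex ^ 'n ^ 'n::finite"
  shows "\<exists>q. q \<noteq> 0 \<and> poly_vec N q v = 0"
proof -
  define f where "f = (\<lambda>i. ((*v) N ^^ i) v)"
  show ?thesis
  proof (cases "inj f")
    case False
    then obtain i j where ij: "i \<noteq> j" "f i = f j" by (auto simp: inj_def)
    have "monom (1::complex) i + monom (- 1) j \<noteq> 0"
    proof
      assume "monom (1::complex) i + monom (- 1) j = 0"
      then have "coeff (monom (1::complex) i + monom (- 1) j) i = 0" by simp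
      then show False using ij by simp
    qed
    moreover have "poly_vec N (monom 1 i + monom (- 1) j) v = 0"
      using ij by (simp add: poly_vec_add poly_vec_monom f_def)
    ultimately show ?thesis by blast
  next
    case True
    let ?S = "f ` {..CARD('n)}"
    have "card ?S = Suc CARD('n)" using True by (simp add: card_image inj_on_subset)
    then have "vec.dependent ?S"
      using vec.independent_bound_general[of ?S] dim_subset_UNIV_cart_gen[of ?S] by auto
    then obtain u where u: "\<exists>w\<in>?S. u w \<noteq> 0" "(\<Sum>w\<in>?S. u w *s w) = 0"
      using vec.dependent_finite[of ?S] by auto
    define q where "q = (\<Sum>i\<le>CARD('n). monom (u (f i)) i)"
    have "poly_vec N q v = (\<Sum>i\<le>CARD('n). u (f i) *s f i)"
      by (simp add: q_def poly_vec_sum poly_vec_monom f_def)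
    also have "\<dots> = (\<Sum>w\<in>?S. u w *s w)"
      using True by (subst sum.reindex) (auto simp: inj_on_def inj_def)
    finally have "poly_vec N q v = 0" using u by simp
    moreover obtain i where i: "i \<le> CARD('n)" "u (f i) \<noteq> 0" using u by auto
    have "coeff q i = u (f i)" using i by (simp add: q_def coeff_sum)
    then have "q \<noteq> 0" using i by auto
    ultimately show ?thesis by blast
  qed
qed

text \<open>Peeling off a linear factor \<open>t - z\<close> of an annihilating polynomial of \<open>v\<close>: either \<open>z\<close> is an
  eigenvalue, and the orbit of \<open>v\<close> satisfies a contracting recurrence driven by the orbit of
  \<open>N v - z v\<close>, or the factor can be cancelled.\<close>

lemma matrix_powers_tendsto_0:
  fixes N :: "complex ^ 'n ^ 'n::finite"
  assumes ev: "\<And>z w. w \<noteq> 0 \<Longrightarrow> N *v w = z *s w \<Longrightarrow> cmod z < 1"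
  shows "(\<lambda>n. norm (((*v) N ^^ n) v)) \<longlonglongrightarrow> 0"
proof -
  have "q \<noteq> 0 \<Longrightarrow> poly_vec N q v = 0 \<Longrightarrow> (\<lambda>n. norm (((*v) N ^^ n) v)) \<longlonglongrightarrow> 0" for q v
  proof (induction "degree q" arbitrary: q v)
    case 0
    then obtain c where "q = [:c:]" "c \<noteq> 0" by (metis degree_eq_zeroE pCons_0_0)
    with 0 have "v = 0" by simp
    moreover have "((*v) N ^^ n) 0 = 0" for n by (induction n) auto
    ultimately show ?case by simp
  next
    case (Suc d)
    obtain z where "poly q z = 0"
      using Suc.hyps(2) fundamental_theorem_of_algebra[of q] by (auto simp: constant_degree)
    then obtain r where r: "q = [:- z, 1:] * r" by (metis dvdE poly_eq_0_iff_dvd)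
    then have "r \<noteq> 0" and dr: "d = degree r"
      using Suc by (auto simp del: mult_pCons_left simp: degree_mult_eq)
    have eq: "N *v poly_vec N r v = z *s poly_vec N r v"
      using Suc.prems(2) unfolding r poly_vec_linear_factor by simp
    show ?case
    proof (cases "poly_vec N r v = 0")
      case True
      then show ?thesis using Suc.hyps(1) dr \<open>r \<noteq> 0\<close> by blast
    next
      case False
      then have "cmod z < 1" using ev eq by blast
      define y where "y = N *v v - z *s v"
      have "poly_vec N r y = 0" unfolding y_def poly_vec_commute using eq by simp
      then have lim: "(\<lambda>n. norm (((*v) N ^^ n) y)) \<longlonglongrightarrow> 0"
        using Suc.hyps(1) dr \<open>r \<noteq> 0\<close> by blast
      have step: "((*v) N ^^ Suc n) v = z *s (((*v) N ^^ n) v) + ((*v) N ^^ n) y" for n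
        by (induction n) (auto simp: y_def vector_scalar_commute matrix_vector_right_distrib)
      have nz: "norm (z *s w) = cmod z * norm w" for w :: "complex ^ 'n"
        by (simp add: norm_vec_def norm_mult L2_set_right_distrib)
      show ?thesis
      proof (rule tendsto_zero_recurrence[OF _ \<open>cmod z < 1\<close> _ lim])
        show "norm (((*v) N ^^ Suc n) v) \<le> cmod z * norm (((*v) N ^^ n) v) + norm (((*v) N ^^ n) y)" for n
          unfolding step nz[symmetric] by (rule norm_triangle_ineq)
      qed auto
    qed
  qed
  then show ?thesis using ex_annihilating_poly by blast
qed

section \<open>Inverse powers of expansive maps\<close>

lemma linear_funpow: "linear f \<Longrightarrow> linear (f ^^ n)" for f :: "'a::real_vector \<Rightarrow> 'a"
  by (induction n) (auto simp: linear_compose linear_id[unfolded id_def] id_def)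

lemma matrix_works_linear: "linear f \<Longrightarrow> matrix f *v x = f x" for f :: "real ^ 'n::finite \<Rightarrow> real ^ 'm::finite"
  by (rule fun_cong[OF matrix_vector_mul(2)])

text \<open>Makes convergence on the finitely many basis vectors uniform over the unit ball.\<close>

lemma norm_linear_le_sum_axis:
  fixes f :: "real ^ 'n::finite \<Rightarrow> 'a::real_normed_vector"
  assumes "linear f"
  shows "norm (f x) \<le> norm x * (\<Sum>i\<in>UNIV. norm (f (axis i 1)))"
proof -
  have "f x = (\<Sum>i\<in>UNIV. (x $ i) *\<^sub>R f (axis i 1))"
  proof -
    have "f x = f (\<Sum>i\<in>UNIV. (x $ i) *\<^sub>R axis i 1)"
      using basis_expansion[of x] by (simp add: scalar_mult_eq_scaleR)
    then show ?thesis using assms by (simp add: linear_sum linear_cmul)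
  qed
  then have "norm (f x) \<le> (\<Sum>i\<in>UNIV. \<bar>x $ i\<bar> * norm (f (axis i 1)))"
    by (metis (no_types, lifting) norm_scaleR norm_sum sum.cong)
  also have "\<dots> \<le> (\<Sum>i\<in>UNIV. norm x * norm (f (axis i 1)))"
    by (intro sum_mono mult_right_mono component_le_norm_cart) auto
  finally show ?thesis by (simp add: sum_distrib_left)
qed

text \<open>The eigenvalue condition concerns complex vectors; this isometric embedding carries the
  iterates of a real map into that setting.\<close>

definition cvec :: "real ^ 'm \<Rightarrow> complex ^ 'm::finite" where
  "cvec v = (\<chi> i. complex_of_real (v $ i))"

lemma cvec_mult: "map_matrix complex_of_real A *v cvec v = cvec (A *v v)"
  by (simp add: cvec_def vec_eq_iff matrix_vector_mult_def)

lemma norm_cvec: "norm (cvec v) = norm v"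
  by (simp add: cvec_def norm_vec_def L2_set_def)

context
  fixes \<phi> :: "real ^ 'n \<Rightarrow> real ^ 'n::finite"
  assumes exp: "expansive_linear \<phi>"
begin

text \<open>A nonzero kernel vector would be an eigenvector for the eigenvalue 0.\<close>

lemma expansive_inj: "inj \<phi>"
proof -
  have lin: "linear \<phi>" using exp by (simp add: expansive_linear_def)
  have "v = 0" if "\<phi> v = 0" for v
  proof (rule ccontr)
    assume "v \<noteq> 0"
    then have "cvec v \<noteq> 0" using norm_cvec[of v] by force
    moreover have "map_matrix complex_of_real (matrix \<phi>) *v cvec v = 0 *s cvec v"
      using that by (simp add: cvec_mult matrix_works_linear[OF lin]) (simp add: cvec_def vec_eq_iff)
    ultimately have "cmod 0 > 1" using exp unfolding expansive_linear_def by blast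
    then show False by simp
  qed
  then show ?thesis using lin by (simp add: linear_injective_0)
qed

text \<open>The eigenvalues of the inverse have modulus below 1, so its powers tend to 0; they are
  applied to \<open>(\<phi> ^^ n) x\<close>.\<close>

lemma expansive_eventually_large:
  assumes "e > 0"
  shows "\<exists>N. \<forall>n\<ge>N. \<forall>x. norm x \<le> e * norm ((\<phi> ^^ n) x)"
proof -
  have lin: "linear \<phi>" using exp by (simp add: expansive_linear_def)
  obtain \<psi> where \<psi>: "linear \<psi>" "\<And>x. \<psi> (\<phi> x) = x" "\<And>x. \<phi> (\<psi> x) = x"
    using linear_injective_isomorphism[OF lin expansive_inj] by blast
  define M where "M = map_matrix complex_of_real (matrix \<phi>)"
  define N where "N = map_matrix complex_of_real (matrix \<psi>)"
  have "matrix \<phi> ** matrix \<psi> = mat 1"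
    using matrix_compose[OF \<psi>(1) lin] \<psi>(3) by (simp add: o_def matrix_id_mat_1[unfolded id_def])
  then have MN: "M ** N = mat 1"
    by (simp add: M_def N_def matrix_matrix_mult_def mat_def vec_eq_iff flip: of_real_mult of_real_sum)
  \<comment> \<open>An eigenvector of \<open>N\<close> for \<open>z\<close> is an eigenvector of
    \<open>M\<close> for \<open>1 / z\<close>.\<close>
  have ev: "cmod z < 1" if "w \<noteq> 0" "N *v w = z *s w" for z w
  proof -
    have "w = M *v (N *v w)" using MN by (simp add: matrix_vector_mul_assoc)
    then have w: "w = z *s (M *v w)" using that(2) by (simp add: vector_scalar_commute)
    then have "z \<noteq> 0" using \<open>w \<noteq> 0\<close> by auto
    then have "M *v w = (1 / z) *s w" using w by (metis divide_self_if vec.scale_one vec.scale_scale times_divide_eq_left mult_1)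
    then have "cmod (1 / z) > 1" using exp \<open>w \<noteq> 0\<close> unfolding expansive_linear_def M_def by blast
    then show ?thesis using \<open>z \<noteq> 0\<close> by (simp add: norm_divide field_simps)
  qed
  have pow: "((*v) N ^^ n) (cvec v) = cvec ((\<psi> ^^ n) v)" for n v
    by (induction n) (auto simp: N_def cvec_mult matrix_works_linear[OF \<psi>(1)])
  have lim: "(\<lambda>n. norm ((\<psi> ^^ n) v)) \<longlonglongrightarrow> 0" for v
    using matrix_powers_tendsto_0[of N "cvec v", OF ev] by (simp add: pow norm_cvec)
  then have "(\<lambda>n. \<Sum>i\<in>UNIV. norm ((\<psi> ^^ n) (axis i 1))) \<longlonglongrightarrow> (\<Sum>i\<in>(UNIV::'n set). 0)"
    by (intro tendsto_sum) auto
  then have "\<forall>\<^sub>F n in sequentially. (\<Sum>i\<in>UNIV. norm ((\<psi> ^^ n) (axis i 1))) < e"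
    using assms by (auto dest: order_tendstoD(2))
  then obtain K where K: "\<And>n. n \<ge> K \<Longrightarrow> (\<Sum>i\<in>UNIV. norm ((\<psi> ^^ n) (axis i 1))) < e"
    by (auto simp: eventually_sequentially)
  have inv: "(\<psi> ^^ n) ((\<phi> ^^ n) x) = x" for n x
  proof (induction n arbitrary: x)
    case (Suc n)
    then show ?case using \<psi>(2) by (simp add: funpow_swap1)
  qed simp
  show ?thesis
  proof (intro exI allI impI)
    fix n x assume n: "K \<le> n"
    have "norm x \<le> norm ((\<phi> ^^ n) x) * (\<Sum>i\<in>UNIV. norm ((\<psi> ^^ n) (axis i 1)))"
      using norm_linear_le_sum_axis[OF linear_funpow[OF \<psi>(1)], of n "(\<phi> ^^ n) x"] by (simp add: inv)
    also have "\<dots> \<le> norm ((\<phi> ^^ n) x) * e"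
      using K[OF n] by (intro mult_left_mono) auto
    finally show "norm x \<le> e * norm ((\<phi> ^^ n) x)" by (simp add: mult.commute)
  qed
qed

end

section \<open>Tiles, translations and grids\<close>

lemma supp_tile_shift: "supp (tile_shift g T) = (+) g ` supp T"
  by (simp add: tile_shift_def)

lemma set_supp_shift: "set_supp (shift g P) = (+) g ` set_supp P"
  by (auto simp: set_supp_def supp_tile_shift)

lemma set_supp_mono: "P \<subseteq> Q \<Longrightarrow> set_supp P \<subseteq> set_supp Q"
  unfolding set_supp_def by blast

lemma shift_add: "shift x (shift y P) = shift (x + y) P"
  by (simp add: image_image tile_shift_add)

lemma shift_subset_iff: "shift x P \<subseteq> Q \<longleftrightarrow> P \<subseteq> shift (- x) Q"
proof -
  have "P \<subseteq> shift (- x) Q" if "shift x P \<subseteq> Q"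
    using image_mono[OF that, of "tile_shift (- x)"] by (simp add: shift_add)
  moreover have "shift x P \<subseteq> Q" if "P \<subseteq> shift (- x) Q"
    using image_mono[OF that, of "tile_shift x"] by (simp add: shift_add)
  ultimately show ?thesis by blast
qed

lemma mem_shift_iff: "T \<in> shift x P \<longleftrightarrow> tile_shift (- x) T \<in> P"
proof
  assume "tile_shift (- x) T \<in> P"
  then have "tile_shift x (tile_shift (- x) T) \<in> shift x P" by blast
  then show "T \<in> shift x P" by (simp add: tile_shift_add)
qed (auto simp: tile_shift_add)

lemma is_tile_tile_shift [simp]: "is_tile (tile_shift g T) \<longleftrightarrow> is_tile T"
proof -
  have "is_tile (tile_shift g T)" if "is_tile T" for g and T :: "('n::finite, 'l) tile"
    using that by (auto simp: is_tile_def supp_tile_shift compact_translation interior_translation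
        closure_translation)
  from this[of T g] this[of "tile_shift g T" "- g"] show ?thesis
    by (auto simp: tile_shift_add)
qed

lemma nonoverlapping_shift [simp]: "nonoverlapping (shift g P) \<longleftrightarrow> nonoverlapping P"
proof -
  have "nonoverlapping (shift g P)" if "nonoverlapping P" for g and P :: "('n::finite, 'l) tile set"
    using that
    by (force simp: nonoverlapping_def pairwise_def supp_tile_shift interior_translation)
  from this[of P g] this[of "shift g P" "- g"] show ?thesis
    by (auto simp: shift_add)
qed

lemma is_patch_shift [simp]: "is_patch (shift g P) \<longleftrightarrow> is_patch P"
proof -
  have "is_patch (shift g P)" if "is_patch P" for g and P :: "('n::finite, 'l) tile set"
    using that by (auto simp: is_patch_def)
  from this[of P g] this[of "shift g P" "- g"] show ?thesis
    by (auto simp: shift_add)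
qed

lemma is_patch_subset: "is_patch Q \<Longrightarrow> P \<subseteq> Q \<Longrightarrow> is_patch P"
  by (auto simp: is_patch_def nonoverlapping_def intro: finite_subset pairwise_subset)

lemma is_tiling_shift:
  assumes "is_tiling T"
  shows "is_tiling (shift g T)"
  using assms surj_plus[of g] by (auto simp: is_tiling_def set_supp_shift)

lemma is_tile_interior_nonempty:
  assumes "is_tile T"
  shows "interior (supp T) \<noteq> {}"
  using assms by (auto simp: is_tile_def)

text \<open>A tile is the closure of its interior, so an open set meeting \<open>supp Q'\<close>,
  even if only at a boundary point, meets its interior; the two interiors then overlap.\<close>

lemma nonoverlapping_eq:
  assumes "nonoverlapping P" "Q \<in> P" "Q' \<in> P" "is_tile Q'"
    and x: "x \<in> interior (supp Q)" "x \<in> supp Q'"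
  shows "Q = Q'"
proof -
  have "x \<in> closure (interior (supp Q'))"
    using assms by (simp add: is_tile_def)
  then have "interior (supp Q) \<inter> interior (supp Q') \<noteq> {}"
    using x(1) open_Int_closure_eq_empty[OF open_interior[of "supp Q"], of "interior (supp Q')"] by blast
  then show ?thesis
    using assms by (auto simp: nonoverlapping_def pairwise_def)
qed

text \<open>An interior point of \<open>Q\<close> lies in some tile of \<open>Y\<close>, which can
  only be \<open>Q\<close>. Agreement of supports is turned into agreement of tiles in this way
  throughout.\<close>

lemma nonoverlapping_mem:
  assumes "nonoverlapping P" "\<And>T. T \<in> P \<Longrightarrow> is_tile T" "Q \<in> P" "Y \<subseteq> P" "supp Q \<subseteq> set_supp Y"
  shows "Q \<in> Y"
proof -
  obtain x where x: "x \<in> interior (supp Q)"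
    using is_tile_interior_nonempty assms(2,3) by blast
  then have "x \<in> set_supp Y" using assms(5) interior_subset by blast
  then obtain Q' where Q': "Q' \<in> Y" "x \<in> supp Q'" unfolding set_supp_def by blast
  have "Q' \<in> P" using Q'(1) assms(4) by blast
  from nonoverlapping_eq[OF assms(1,3) this assms(2)[OF this] x Q'(2)] have "Q = Q'" .
  then show ?thesis using Q' by simp
qed

text \<open>A linear map carries translates to translates, so one covering of \<open>K\<close>
  bounds the volumes of its images under all linear maps with the same number of pieces.\<close>

lemma measure_open_translates_le:
  fixes K U :: "'a::euclidean_space set"
  assumes lin: "linear f" and F: "finite F" and cov: "K \<subseteq> (\<Union>x\<in>F. (+) x ` U)"
    and lm: "f ` K \<in> lmeasurable" "f ` U \<in> lmeasurable"
  shows "measure lebesgue (f ` K) \<le> real (card F) * measure lebesgue (f ` U :: 'a set)"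
proof -
  have eq: "f ` (+) x ` U = (+) (f x) ` f ` U" for x
    using linear_add[OF lin] by (auto simp: image_image)
  have "f ` K \<subseteq> (\<Union>x\<in>F. (+) (f x) ` f ` U)"
    using image_mono[OF cov, of f] by (simp only: image_UN eq)
  then have "measure lebesgue (f ` K) \<le> measure lebesgue (\<Union>x\<in>F. (+) (f x) ` f ` U)"
    using F lm by (intro measure_mono_fmeasurable fmeasurable.finite_UN measurable_translation)
      (auto intro: fmeasurableD)
  also have "\<dots> \<le> (\<Sum>x\<in>F. measure lebesgue ((+) (f x) ` f ` U))"
    using F lm by (intro measure_UNION_le) (auto intro!: fmeasurableD measurable_translation)
  also have "\<dots> = real (card F) * measure lebesgue (f ` U)"
    by (simp add: measure_translation)
  finally show ?thesis .
qed

lemma finite_subset_UN_mono: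
  fixes F :: "nat \<Rightarrow> 'a set"
  assumes "finite P" "P \<subseteq> (\<Union>i. F i)" "mono F"
  shows "\<exists>i. P \<subseteq> F i"
  using assms(1,2)
proof (induction P rule: finite_induct)
  case (insert a P)
  then obtain i j where "P \<subseteq> F i" "a \<in> F j" by auto
  moreover have "F i \<subseteq> F (max i j)" "F j \<subseteq> F (max i j)" by (intro monoD[OF assms(3)] max.cobounded1 max.cobounded2)+
  ultimately show ?case by blast
qed simp

section \<open>Small distances between tilings\<close>

lemma tiling_dist_le:
  assumes "0 < r" "r < 2 powr (- 1 / 2)" "ball 0 (1 / r) \<subseteq> set_supp (S \<inter> V)"
  shows "tiling_dist S V \<le> r"
proof -
  define D where "D = {r. 0 < r \<and> r < 2 powr (- 1 / 2) \<and>
    (\<exists>g. norm g \<le> r \<and> ball 0 (1 / r) \<subseteq> set_supp (shift (- g) S \<inter> V))}"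
  have "r \<in> D" using assms unfolding D_def by (auto intro!: exI[of _ 0])
  moreover have "bdd_below D" by (rule bdd_belowI[of _ 0]) (auto simp: D_def)
  ultimately have "Inf D \<le> r" "D \<noteq> {}" by (auto intro: cInf_lower)
  then show ?thesis unfolding tiling_dist_def Let_def D_def[symmetric] by auto
qed

lemma tiling_dist_lessE:
  assumes "tiling_dist S V < e" "e \<le> 2 powr (- 1 / 2)"
  obtains r g where "0 < r" "r < e" "norm g \<le> r" "ball 0 (1 / r) \<subseteq> set_supp (shift (- g) S \<inter> V)"
proof -
  define D where "D = {r. 0 < r \<and> r < 2 powr (- 1 / 2) \<and>
    (\<exists>g. norm g \<le> r \<and> ball 0 (1 / r) \<subseteq> set_supp (shift (- g) S \<inter> V))}"
  have eq: "tiling_dist S V = (if D = {} then 2 powr (- 1 / 2) else min (2 powr (- 1 / 2)) (Inf D))"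
    unfolding tiling_dist_def Let_def D_def ..
  \<comment> \<open>If \<open>D\<close> were empty, the distance would be the default
    \<open>2 powr (- 1 / 2)\<close>, which is at least \<open>e\<close>.\<close>
  have "D \<noteq> {}" using assms eq by (auto split: if_splits)
  moreover from this have "Inf D < e" using assms eq by (auto simp: min_less_iff_disj)
  ultimately obtain r where "r \<in> D" "r < e" using cInf_lessD by blast
  then show ?thesis using that by (auto simp: D_def)
qed

section \<open>Unit boxes on an integer grid\<close>

lemma measure_unit_box_cart: "measure lebesgue (box x (x + 1 :: real ^ 'n::finite)) = 1"
proof -
  have "x \<in> cbox x (x + 1)" by (simp add: mem_box_cart)
  then have "measure lborel (cbox x (x + 1)) = 1"
    by (subst content_cbox_cart) auto
  then show ?thesis by (simp add: measure_completion measure_lborel_box_eq measure_lborel_cbox_eq)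
qed

text \<open>Each grid point is the lower corner of its own unit box in the cube of side
  \<open>L\<close>; counting grid points thereby becomes a comparison of volumes.\<close>

definition grid :: "nat \<Rightarrow> (real ^ 'n::finite) set" where
  "grid L = (\<lambda>f. \<chi> i. real (f i)) ` (UNIV \<rightarrow>\<^sub>E {..<L})"

lemma finite_grid: "finite (grid L)"
  unfolding grid_def by (intro finite_imageI finite_PiE) auto

lemma card_grid: "card (grid L :: (real ^ 'n::finite) set) = L ^ CARD('n)"
proof -
  have "inj_on (\<lambda>f. \<chi> i. real (f i) :: real ^ 'n) (UNIV \<rightarrow>\<^sub>E {..<L})"
    by (intro inj_onI) (auto simp: vec_eq_iff)
  then show ?thesis unfolding grid_def by (simp add: card_image card_PiE)
qed

lemma grid_component:
  assumes "x \<in> grid L"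
  obtains l where "l < L" "x $ i = real l"
proof -
  obtain f where "f \<in> UNIV \<rightarrow>\<^sub>E {..<L}" "x = (\<chi> i. real (f i))"
    using assms unfolding grid_def by blast
  then show ?thesis using that[of "f i"] by (simp add: PiE_iff)
qed

lemma grid_boxes_disjoint:
  assumes "x \<in> grid L" "y \<in> grid L" "x \<noteq> y"
  shows "box x (x + 1) \<inter> box y (y + 1) = {}"
proof (rule ccontr)
  assume "box x (x + 1) \<inter> box y (y + 1) \<noteq> {}"
  then obtain u where u: "u \<in> box x (x + 1)" "u \<in> box y (y + 1)" by blast
  have "x $ i = y $ i" for i
  proof -
    obtain k where k: "x $ i = real k" by (rule grid_component[OF assms(1)])
    obtain l where l: "y $ i = real l" by (rule grid_component[OF assms(2)])
    have "x $ i < u $ i" "u $ i < x $ i + 1" "y $ i < u $ i" "u $ i < y $ i + 1"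
      using u by (auto simp: mem_box_cart)
    then have "real k < real (l + 1)" "real l < real (k + 1)" unfolding k l by linarith+
    then have "k = l" unfolding of_nat_less_iff by linarith
    then show ?thesis unfolding k l by simp
  qed
  then show False using assms(3) by (simp add: vec_eq_iff)
qed

lemma measure_cube_cart:
  fixes z :: "real ^ 'm::finite"
  assumes "a \<le> b"
  shows "measure lebesgue ((+) z ` cbox (\<chi> i. a) (\<chi> i. b)) = (b - a) ^ CARD('m)"
proof -
  have "(\<chi> i. a) \<in> (cbox (\<chi> i. a) (\<chi> i. b) :: (real ^ 'm) set)" using assms by (simp add: mem_box_cart)
  then have "measure lborel (cbox (\<chi> i. a) (\<chi> i. b) :: (real ^ 'm) set) = (b - a) ^ CARD('m)"
    by (subst content_cbox_cart) auto
  then show ?thesis by (simp add: measure_translation measure_completion)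
qed

text \<open>The crude factor \<open>CARD('n)\<close> comes from the l1 norm; it returns below as the
  gap between \<open>R\<close> and \<open>R'\<close>.\<close>

lemma norm_le_card_cart:
  fixes x :: "real ^ 'm::finite"
  assumes "\<And>i. \<bar>x $ i\<bar> \<le> c"
  shows "norm x \<le> real CARD('m) * c"
proof -
  have "norm x \<le> (\<Sum>i\<in>UNIV. \<bar>x $ i\<bar>)" by (rule norm_le_l1_cart)
  also have "\<dots> \<le> (\<Sum>i\<in>(UNIV :: 'm set). c)" using assms by (intro sum_mono) auto
  finally show ?thesis by simp
qed

section \<open>Iterates of a tile substitution\<close>

locale tile_subst =
  fixes \<phi> :: "real ^ 'n \<Rightarrow> real ^ 'n::finite"
    and \<A> :: "('n, 'l) tile set"
    and \<omega> :: "('n, 'l) tile \<Rightarrow> ('n, 'l) tile set"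
  assumes subst: "tile_substitution \<phi> \<A> \<omega>"
begin

abbreviation infl :: "nat \<Rightarrow> ('n, 'l) tile set \<Rightarrow> ('n, 'l) tile set" where
  "infl n P \<equiv> (subst_set \<phi> \<A> \<omega> ^^ n) P"

definition proto_copy :: "('n, 'l) tile \<Rightarrow> bool" where
  "proto_copy T \<longleftrightarrow> (\<exists>A\<in>\<A>. \<exists>x. T = tile_shift x A)"

abbreviation X where "X \<equiv> tiling_space \<phi> \<A> \<omega>"

lemma proto: "is_prototile_set \<A>" and expansive: "expansive_linear \<phi>"
  and om: "A \<in> \<A> \<Longrightarrow> \<omega> A \<in> patches_over \<A>" "A \<in> \<A> \<Longrightarrow> set_supp (\<omega> A) = \<phi> ` supp A"
  using subst by (auto simp: tile_substitution_def)

lemma finite_\<A>: "finite \<A>"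
  using proto by (simp add: is_prototile_set_def)

lemma lin: "linear \<phi>"
  using expansive by (simp add: expansive_linear_def)

lemma inj: "inj \<phi>"
  by (rule expansive_inj[OF expansive])

lemma lin_pow: "linear (\<phi> ^^ n)"
  by (rule linear_funpow[OF lin])

lemma inj_pow: "inj (\<phi> ^^ n)"
  by (rule inj_fn[OF inj])

lemma surj_pow: "surj (\<phi> ^^ n)"
  by (rule linear_inj_imp_surj[OF lin_pow inj_pow])

lemma cont_pow: "continuous_on S (\<phi> ^^ n)"
  by (rule linear_continuous_on) (use lin_pow linear_conv_bounded_linear in blast)

lemma interior_pow: "interior ((\<phi> ^^ n) ` S) = (\<phi> ^^ n) ` interior S"
  by (rule interior_injective_linear_image[OF lin_pow inj_pow])

lemma open_pow: "open U \<Longrightarrow> open ((\<phi> ^^ n) ` U)"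
  using interior_pow[of n U] by (metis interior_eq)

lemma compact_pow: "compact K \<Longrightarrow> compact ((\<phi> ^^ n) ` K)"
  by (rule compact_continuous_image[OF cont_pow])

lemma pow_translation: "(\<phi> ^^ n) ` (+) x ` S = (+) ((\<phi> ^^ n) x) ` (\<phi> ^^ n) ` S"
  using linear_add[OF lin_pow] by (auto simp: image_image)

lemma proto_copy_proto [intro]: "A \<in> \<A> \<Longrightarrow> proto_copy A"
  by (force simp: proto_copy_def intro: exI[of _ 0])

lemma proto_copy_is_tile: "proto_copy T \<Longrightarrow> is_tile T"
  using proto by (auto simp: proto_copy_def is_prototile_set_def)

lemma proto_copy_tile_shift [simp]: "proto_copy (tile_shift g T) \<longleftrightarrow> proto_copy T"
proof -
  have "proto_copy (tile_shift g T)" if "proto_copy T" for g T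
    using that unfolding proto_copy_def by (metis tile_shift_add)
  from this[of T g] this[of "tile_shift g T" "- g"] show ?thesis by (auto simp: tile_shift_add)
qed

lemma patches_over_iff: "P \<in> patches_over \<A> \<longleftrightarrow> finite P \<and> nonoverlapping P \<and> (\<forall>T\<in>P. proto_copy T)"
  using proto_copy_is_tile by (auto simp: patches_over_def is_patch_def proto_copy_def)

lemma patches_over_subset: "P \<in> patches_over \<A> \<Longrightarrow> Q \<subseteq> P \<Longrightarrow> Q \<in> patches_over \<A>"
  unfolding patches_over_iff nonoverlapping_def by (meson finite_subset pairwise_subset subsetD)

lemma proto_copy_singleton: "proto_copy T \<Longrightarrow> {T} \<in> patches_over \<A>"
  by (simp add: patches_over_iff nonoverlapping_def)

lemma patches_over_shift [simp]: "shift g P \<in> patches_over \<A> \<longleftrightarrow> P \<in> patches_over \<A>"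
proof -
  have "shift g P \<in> patches_over \<A>" if "P \<in> patches_over \<A>" for g P
    using that by (auto simp: patches_over_iff)
  from this[of P g] this[of "shift g P" "- g"] show ?thesis
    by (auto simp: shift_add)
qed

lemma subst_shift: "subst_set \<phi> \<A> \<omega> (shift x P) = shift (\<phi> x) (subst_set \<phi> \<A> \<omega> P)"
proof -
  have sub: "shift (\<phi> x) (subst_set \<phi> \<A> \<omega> P) \<subseteq> subst_set \<phi> \<A> \<omega> (shift x P)" for x P
  proof
    fix T assume "T \<in> shift (\<phi> x) (subst_set \<phi> \<A> \<omega> P)"
    then obtain y A where yA: "A \<in> \<A>" "tile_shift y A \<in> P" "T \<in> shift (\<phi> x) (shift (\<phi> y) (\<omega> A))"
      unfolding subst_set_def by blast
    then have "T \<in> shift (\<phi> (x + y)) (\<omega> A)"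
      by (simp only: shift_add linear_add[OF lin])
    moreover have "tile_shift (x + y) A \<in> shift x P"
      using yA(2) by (metis imageI tile_shift_add)
    ultimately show "T \<in> subst_set \<phi> \<A> \<omega> (shift x P)"
      unfolding subst_set_def using yA(1) by blast
  qed
  \<comment> \<open>The converse inclusion is \<open>sub\<close> for the opposite shift.\<close>
  have "subst_set \<phi> \<A> \<omega> (shift x P) \<subseteq> shift (\<phi> x) (subst_set \<phi> \<A> \<omega> P)"
    using sub[of "- x" "shift x P"]
    by (simp add: shift_subset_iff shift_add linear_neg[OF lin])
  then show ?thesis using sub[of x P] by blast
qed

lemma infl_shift: "infl n (shift x P) = shift ((\<phi> ^^ n) x) (infl n P)"
  by (induction n) (auto simp: subst_shift)

lemma subst_mono: "P \<subseteq> Q \<Longrightarrow> subst_set \<phi> \<A> \<omega> P \<subseteq> subst_set \<phi> \<A> \<omega> Q"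
  unfolding subst_set_def by blast

lemma infl_mono: "P \<subseteq> Q \<Longrightarrow> infl n P \<subseteq> infl n Q"
  by (induction n) (auto dest: subst_mono)

lemma infl_Union: "infl n P = (\<Union>T\<in>P. infl n {T})"
proof (induction n)
  case (Suc n)
  have "infl (Suc n) P = subst_set \<phi> \<A> \<omega> (\<Union>T\<in>P. infl n {T})"
    using Suc by simp
  also have "\<dots> = (\<Union>T\<in>P. subst_set \<phi> \<A> \<omega> (infl n {T}))"
    unfolding subst_set_def by blast
  finally show ?case by simp
qed simp

lemma infl_add: "infl (m + n) P = infl m (infl n P)"
  by (simp add: funpow_add)

lemma subst_tile:
  assumes "proto_copy T"
  shows "subst_set \<phi> \<A> \<omega> {T} \<in> patches_over \<A>" "set_supp (subst_set \<phi> \<A> \<omega> {T}) = \<phi> ` supp T"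
proof -
  obtain A x where A: "A \<in> \<A>" "T = tile_shift x A" using assms by (auto simp: proto_copy_def)
  have eq: "subst_set \<phi> \<A> \<omega> {T} = shift (\<phi> x) (\<omega> A)"
    using subst_set_tile[OF proto A(1)] A(2) by simp
  show "subst_set \<phi> \<A> \<omega> {T} \<in> patches_over \<A>" unfolding eq using om A by simp
  show "set_supp (subst_set \<phi> \<A> \<omega> {T}) = \<phi> ` supp T"
    unfolding eq using om A pow_translation[of 1 x] by (simp add: set_supp_shift supp_tile_shift)
qed

text \<open>Tiles with different parents stay inside the images of disjoint interiors, and these
  remain disjoint and open because \<open>\<phi>\<close> is a linear injection.\<close>

lemma subst_patch:
  assumes "P \<in> patches_over \<A>"
  shows "subst_set \<phi> \<A> \<omega> P \<in> patches_over \<A>" "set_supp (subst_set \<phi> \<A> \<omega> P) = \<phi> ` set_supp P"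
proof -
  have P: "finite P" "nonoverlapping P" "\<And>T. T \<in> P \<Longrightarrow> proto_copy T"
    using assms by (auto simp: patches_over_iff)
  note t = subst_tile[OF P(3)]
  have "nonoverlapping (subst_set \<phi> \<A> \<omega> P)"
    unfolding nonoverlapping_def pairwise_def
  proof (intro ballI impI)
    fix Q1 Q2 assume Q: "Q1 \<in> subst_set \<phi> \<A> \<omega> P" "Q2 \<in> subst_set \<phi> \<A> \<omega> P" "Q1 \<noteq> Q2"
    then obtain T1 T2 where T: "T1 \<in> P" "T2 \<in> P" "Q1 \<in> subst_set \<phi> \<A> \<omega> {T1}" "Q2 \<in> subst_set \<phi> \<A> \<omega> {T2}"
      using subst_set_Union[of \<phi> \<A> \<omega> P] by auto
    show "interior (supp Q1) \<inter> interior (supp Q2) = {}"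
    proof (cases "T1 = T2")
      case True
      then show ?thesis using t(1)[OF T(1)] T Q(3)
        by (auto simp: patches_over_iff nonoverlapping_def pairwise_def)
    next
      case False
      have int: "interior (supp Q) \<subseteq> \<phi> ` interior (supp T)" if "T \<in> P" "Q \<in> subst_set \<phi> \<A> \<omega> {T}" for Q T
      proof -
        have "supp Q \<subseteq> \<phi> ` supp T" using t(2)[OF that(1)] that(2) by (auto simp: set_supp_def)
        from interior_mono[OF this] show ?thesis using interior_pow[of 1] by simp
      qed
      have "interior (supp T1) \<inter> interior (supp T2) = {}"
        using P(2) T False by (auto simp: nonoverlapping_def pairwise_def)
      then have "\<phi> ` interior (supp T1) \<inter> \<phi> ` interior (supp T2) = {}"
        by (metis image_Int[OF inj] image_empty)
      then show ?thesis using int[OF T(1,3)] int[OF T(2,4)] by blast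
    qed
  qed
  moreover have "finite (subst_set \<phi> \<A> \<omega> P)" "\<forall>T\<in>subst_set \<phi> \<A> \<omega> P. proto_copy T"
    using P t(1) by (subst subst_set_Union; auto simp: patches_over_iff)+
  ultimately show "subst_set \<phi> \<A> \<omega> P \<in> patches_over \<A>" by (simp add: patches_over_iff)
  have "set_supp (subst_set \<phi> \<A> \<omega> P) = (\<Union>T\<in>P. set_supp (subst_set \<phi> \<A> \<omega> {T}))"
    by (subst subst_set_Union) (auto simp: set_supp_def)
  also have "\<dots> = \<phi> ` set_supp P" using t(2) by (auto simp: set_supp_def)
  finally show "set_supp (subst_set \<phi> \<A> \<omega> P) = \<phi> ` set_supp P" .
qed

lemma infl_patch:
  assumes "P \<in> patches_over \<A>"
  shows "infl n P \<in> patches_over \<A>" "set_supp (infl n P) = (\<phi> ^^ n) ` set_supp P"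
  using assms by (induction n) (auto simp: subst_patch)

lemma infl_tile:
  assumes "proto_copy T"
  shows "infl n {T} \<in> patches_over \<A>" "set_supp (infl n {T}) = (\<phi> ^^ n) ` supp T"
  using infl_patch[OF proto_copy_singleton[OF assms]] by (auto simp: set_supp_def)

lemma infl_tileD:
  assumes "proto_copy T" "Q \<in> infl n {T}"
  shows "proto_copy Q" "supp Q \<subseteq> (\<phi> ^^ n) ` supp T"
  using assms infl_tile[OF assms(1), of n] by (auto simp: patches_over_iff set_supp_def)

lemma infl_tile_nonempty: "proto_copy T \<Longrightarrow> infl n {T} \<noteq> {}"
  using infl_tile(2)[of T n] proto_copy_is_tile[of T] by (auto simp: set_supp_def is_tile_def)

lemma infl_trans: "Q \<in> infl m {T} \<Longrightarrow> infl n {Q} \<subseteq> infl (n + m) {T}"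
  using infl_mono[of "{Q}"] by (simp add: infl_add)

lemma patch_mem:
  assumes "P \<in> patches_over \<A>" "Q \<in> P" "Y \<subseteq> P" "supp Q \<subseteq> set_supp Y"
  shows "Q \<in> Y"
  using assms nonoverlapping_mem[of P Q Y] proto_copy_is_tile by (auto simp: patches_over_iff)

text \<open>Uniformity comes from the finite number of prototiles, each with 0 in its interior.
  Diameters, margins and volume ratios below are built from these two radii.\<close>

lemma proto_copy_radii:
  obtains r D where "r > 0" "D > 0" "\<And>T. proto_copy T \<Longrightarrow> \<exists>x. ball x r \<subseteq> supp T \<and> supp T \<subseteq> ball x D"
proof -
  have "\<exists>r>0. ball 0 r \<subseteq> supp A" if "A \<in> \<A>" for A
    using proto that by (auto simp: is_prototile_set_def mem_interior)
  then obtain r where r: "\<And>A. A \<in> \<A> \<Longrightarrow> r A > 0 \<and> ball 0 (r A) \<subseteq> supp A" by metis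
  have "\<exists>D>0. supp A \<subseteq> ball 0 D" if "A \<in> \<A>" for A
  proof -
    have "bounded (supp A)"
      using proto that by (auto simp: is_prototile_set_def is_tile_def intro: compact_imp_bounded)
    then show ?thesis using bounded_subset_ballD by blast
  qed
  then obtain D where D: "\<And>A. A \<in> \<A> \<Longrightarrow> D A > 0 \<and> supp A \<subseteq> ball 0 (D A)" by metis
  \<comment> \<open>Inserting 1 keeps minimum and maximum meaningful when \<open>\<A>\<close> is
    empty.\<close>
  let ?r = "Min (insert 1 (r ` \<A>))" and ?D = "Max (insert 1 (D ` \<A>))"
  have fin: "finite (insert 1 (r ` \<A>))" "finite (insert 1 (D ` \<A>))" using finite_\<A> by auto
  show ?thesis
  proof
    show "?r > 0" using r fin by (subst Min_gr_iff) auto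
    have "?D \<ge> 1" using fin by (intro Max_ge) auto
    then show "?D > 0" by linarith
    fix T assume "proto_copy T"
    then obtain A x where A: "A \<in> \<A>" "T = tile_shift x A" by (auto simp: proto_copy_def)
    have "?r \<le> r A" "D A \<le> ?D" using A fin by (auto intro!: Min_le Max_ge)
    then have "ball 0 ?r \<subseteq> supp A" "supp A \<subseteq> ball 0 ?D"
      using r[OF A(1)] D[OF A(1)] by (meson subset_ball subset_trans)+
    then have "(+) x ` ball 0 ?r \<subseteq> supp T" "supp T \<subseteq> (+) x ` ball 0 ?D"
      unfolding A(2) supp_tile_shift by blast+
    then show "\<exists>x. ball x ?r \<subseteq> supp T \<and> supp T \<subseteq> ball x ?D"
      using ball_translation[of x 0 ?r] ball_translation[of x 0 ?D] by (metis add_0_right)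
  qed
qed

section \<open>Tilings in the tiling space\<close>

lemma X_shift: "T \<in> X \<Longrightarrow> shift g T \<in> X"
proof -
  assume T: "T \<in> X"
  have "legal \<phi> \<A> \<omega> P" if P: "P \<subseteq> shift g T" "finite P" for P
  proof -
    have "shift (- g) P \<subseteq> T" using P by (simp add: shift_subset_iff)
    then have "legal \<phi> \<A> \<omega> (shift (- g) P)" using T P by (auto simp: tiling_space_def)
    then show ?thesis unfolding legal_def by (auto simp: shift_add)
  qed
  then show ?thesis using T by (auto simp: tiling_space_def is_tiling_shift)
qed

lemma X_shift_iff [simp]: "shift g T \<in> X \<longleftrightarrow> T \<in> X"
  using X_shift[of T g] X_shift[of "shift g T" "- g"] by (auto simp: shift_add)

text \<open>Tilings are defined with arbitrary tiles; legality of one-tile patches confines them to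
  translates of prototiles.\<close>

lemma X_proto_copy:
  assumes "T \<in> X" "Q \<in> T"
  shows "proto_copy Q"
proof -
  have "legal \<phi> \<A> \<omega> {Q}" using assms by (auto simp: tiling_space_def)
  then obtain n A x where "A \<in> \<A>" "tile_shift x Q \<in> infl n {A}" unfolding legal_def by auto
  then have "proto_copy (tile_shift x Q)" using infl_tileD by blast
  then show ?thesis by simp
qed

lemma X_cover:
  assumes "T \<in> X"
  obtains Q where "Q \<in> T" "y \<in> supp Q"
proof -
  have "y \<in> set_supp T" using assms by (simp add: tiling_space_def is_tiling_def)
  then show ?thesis using that unfolding set_supp_def by blast
qed

text \<open>Centres of inner balls of distinct tiles are at least \<open>r\<close> apart, since a
  centre closer to another one would be an interior point of its own tile lying in the other tile. A
  bounded set of such centres is finite.\<close>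

lemma X_finite_meet:
  assumes T: "T \<in> X" and B: "bounded B"
  shows "finite {Q \<in> T. supp Q \<inter> B \<noteq> {}}"
proof -
  let ?P = "{Q \<in> T. supp Q \<inter> B \<noteq> {}}"
  obtain r D where rD: "r > 0" "D > 0" "\<And>T. proto_copy T \<Longrightarrow> \<exists>x. ball x r \<subseteq> supp T \<and> supp T \<subseteq> ball x D"
    using proto_copy_radii by metis
  obtain c where c: "\<And>Q. Q \<in> ?P \<Longrightarrow> ball (c Q) r \<subseteq> supp Q \<and> supp Q \<subseteq> ball (c Q) D"
    using rD(3) X_proto_copy[OF T] by (metis (no_types, lifting) mem_Collect_eq)
  have sep: "Q = Q'" if "Q \<in> ?P" "Q' \<in> ?P" "dist (c Q) (c Q') < r" for Q Q'
  proof (rule nonoverlapping_eq[of T])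
    show "nonoverlapping T" using T by (simp add: tiling_space_def is_tiling_def)
    show "Q \<in> T" "Q' \<in> T" using that by auto
    then show "is_tile Q'" using X_proto_copy[OF T] proto_copy_is_tile by blast
    show "c Q \<in> interior (supp Q)" using c[OF that(1)] rD(1) by (auto simp: mem_interior)
    show "c Q \<in> supp Q'" using c[OF that(2)] that(3) by (auto simp: dist_commute)
  qed
  obtain b where b: "\<And>y. y \<in> B \<Longrightarrow> norm y \<le> b" using B by (auto simp: bounded_iff)
  have "norm (c Q) \<le> b + D" if Q: "Q \<in> ?P" for Q
  proof -
    obtain y where y: "y \<in> supp Q" "y \<in> B" using Q by auto
    have "y \<in> ball (c Q) D" using c[OF Q] y(1) by blast
    then have "dist (c Q) y < D" "norm y \<le> b" using b[OF y(2)] by auto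
    then show ?thesis using norm_triangle_sub[of "c Q" y] by (simp add: dist_norm)
  qed
  then have sub: "c ` ?P \<subseteq> cball 0 (b + D)"
    by (intro image_subsetI) (simp only: mem_cball_0)
  have "\<not> x islimpt c ` ?P" for x
  proof (rule discrete_imp_not_islimpt[OF rD(1)])
    fix x y assume "x \<in> c ` ?P" "y \<in> c ` ?P" and d: "dist y x < r"
    then obtain Q Q' where Q: "Q \<in> ?P" "Q' \<in> ?P" "x = c Q" "y = c Q'" by blast
    show "y = x" using sep[OF Q(2,1)] d Q(3,4) by simp
  qed
  then have "finite (cball 0 (b + D) \<inter> c ` ?P)"
    by (intro finite_not_islimpt_in_compact) (auto simp: Int_absorb1[OF sub])
  then have "finite (c ` ?P)" by (simp add: Int_absorb1[OF sub])
  moreover have "inj_on c ?P"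
  proof (rule inj_onI)
    fix Q Q' assume "Q \<in> ?P" "Q' \<in> ?P" "c Q = c Q'"
    then show "Q = Q'" using sep[of Q Q'] rD(1) by simp
  qed
  ultimately show ?thesis by (simp add: finite_image_iff)
qed

text \<open>Local finiteness makes a bounded piece of \<open>T\<close> a patch, and legality then
  places it in one supertile.\<close>

lemma X_capture:
  assumes T: "T \<in> X" and B: "bounded B"
  obtains z n A where "A \<in> \<A>" "n \<ge> 1" "shift z {Q \<in> T. supp Q \<inter> B \<noteq> {}} \<subseteq> infl n {A}"
proof -
  have "legal \<phi> \<A> \<omega> {Q \<in> T. supp Q \<inter> B \<noteq> {}}"
    using T X_finite_meet[OF assms] by (auto simp: tiling_space_def)
  then show ?thesis using that unfolding legal_def by blast
qed


section \<open>Final prototiles\<close>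

text \<open>The positions of the positive entries of the n-th power of the substitution
  matrix.\<close>

definition occ :: "nat \<Rightarrow> (('n, 'l) tile \<times> ('n, 'l) tile) set" where
  "occ n = {(A, B). A \<in> \<A> \<and> B \<in> \<A> \<and> (\<exists>x. tile_shift x B \<in> infl n {A})}"

lemma occ_dom: "(A, B) \<in> occ n \<Longrightarrow> A \<in> \<A>" "(A, B) \<in> occ n \<Longrightarrow> B \<in> \<A>"
  by (auto simp: occ_def)

lemma occI: "A \<in> \<A> \<Longrightarrow> B \<in> \<A> \<Longrightarrow> tile_shift x B \<in> infl n {A} \<Longrightarrow> (A, B) \<in> occ n"
  unfolding occ_def by blast

lemma occE:
  assumes "A \<in> \<A>" "Q \<in> infl n {A}"
  obtains B x where "(A, B) \<in> occ n" "Q = tile_shift x B"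
proof -
  have "proto_copy Q" using infl_tileD[OF proto_copy_proto] assms by blast
  then show ?thesis using that occI[OF assms(1)] assms(2) unfolding proto_copy_def by blast
qed

lemma infl_tile_shift: "infl n {tile_shift x A} = shift ((\<phi> ^^ n) x) (infl n {A})"
  using infl_shift[of n x "{A}"] by simp

lemma occ_infl:
  assumes "(A, B) \<in> occ k"
  shows "\<exists>x. shift x (infl M {B}) \<subseteq> infl (M + k) {A}"
proof -
  obtain x where "tile_shift x B \<in> infl k {A}" using assms by (auto simp: occ_def)
  from infl_trans[OF this, of M] show ?thesis unfolding infl_tile_shift by blast
qed

text \<open>Boolean matrix multiplication: each tile of \<open>infl (m + n) {A}\<close> descends
  from a tile of \<open>infl n {A}\<close>.\<close>

lemma occ_add: "occ (m + n) = occ n O occ m"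
proof (intro subset_antisym subsetI)
  fix z assume "z \<in> occ (m + n)"
  then obtain A B x where z: "z = (A, B)" "A \<in> \<A>" "B \<in> \<A>" "tile_shift x B \<in> infl (m + n) {A}"
    unfolding occ_def by blast
  then have "tile_shift x B \<in> (\<Union>Q\<in>infl n {A}. infl m {Q})"
    using infl_Union[of m "infl n {A}"] unfolding infl_add by simp
  then obtain Q where Q: "Q \<in> infl n {A}" "tile_shift x B \<in> infl m {Q}" by blast
  obtain C y where C: "(A, C) \<in> occ n" "Q = tile_shift y C" using occE[OF z(2) Q(1)] by metis
  have "tile_shift x B \<in> shift ((\<phi> ^^ m) y) (infl m {C})" using Q(2) C(2) infl_tile_shift by simp
  then have "tile_shift (- (\<phi> ^^ m) y + x) B \<in> infl m {C}" by (simp add: mem_shift_iff tile_shift_add)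
  then have "(C, B) \<in> occ m" using occI occ_dom(2)[OF C(1)] z(3) by blast
  then show "z \<in> occ n O occ m" using C(1) z(1) by blast
next
  fix z assume "z \<in> occ n O occ m"
  then obtain A B C where z: "z = (A, B)" "(A, C) \<in> occ n" "(C, B) \<in> occ m" by auto
  obtain x where x: "shift x (infl m {C}) \<subseteq> infl (m + n) {A}" using occ_infl[OF z(2)] by blast
  obtain y where "tile_shift y B \<in> infl m {C}" using z(3) by (auto simp: occ_def)
  then have "tile_shift (x + y) B \<in> shift x (infl m {C})" by (metis imageI tile_shift_add)
  then have "tile_shift (x + y) B \<in> infl (m + n) {A}" using x by (rule subsetD[rotated])
  then show "z \<in> occ (m + n)" unfolding z(1) by (rule occI[OF occ_dom(1)[OF z(2)] occ_dom(2)[OF z(3)]])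
qed

text \<open>The powers of a relation on a finite set are eventually periodic, so some power is
  idempotent.\<close>

lemma ex_period: "\<exists>p\<ge>1. occ (p + p) = occ p"
proof -
  have "range occ \<subseteq> Pow (\<A> \<times> \<A>)" unfolding occ_def by blast
  then have "finite (range occ)" using finite_\<A> by (meson finite_Pow_iff finite_SigmaI finite_subset)
  then have "\<not> inj occ" using finite_imageD infinite_UNIV_nat by blast
  then obtain i j where "i \<noteq> j" "occ i = occ j" by (auto simp: inj_def)
  then obtain i j where ij: "i < j" "occ i = occ j" by (metis linorder_neqE_nat)
  define d where "d = j - i"
  have d: "d \<ge> 1" using ij by (simp add: d_def)
  have one: "occ (k + i + d) = occ (k + i)" for k
    using occ_add[of k i] occ_add[of k j] ij by (simp add: d_def)
  have per: "occ (k + i + d * m) = occ (k + i)" for k m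
  proof (induction m)
    case (Suc m)
    have "occ (k + i + d * Suc m) = occ (k + d * m + i + d)" by (simp add: algebra_simps)
    also have "\<dots> = occ (k + d * m + i)" by (rule one)
    finally show ?case using Suc by (simp add: algebra_simps)
  qed simp
  \<comment> \<open>An idempotent exponent must be a multiple of the eventual period
    \<open>d\<close> and lie beyond the preperiod \<open>i\<close>; this one does both.\<close>
  define p where "p = d * (i + 1)"
  have "i + 1 \<le> p" using mult_right_mono[OF d, of "i + 1"] by (simp add: p_def)
  then have "occ (p - i + i + d * (i + 1)) = occ (p - i + i)" using per by blast
  then have "occ (p + p) = occ p" using \<open>i + 1 \<le> p\<close> by (simp add: p_def)
  then show ?thesis using \<open>i + 1 \<le> p\<close> by (intro exI[of _ p]) auto
qed

definition period :: nat where
  "period = (SOME p. p \<ge> 1 \<and> occ (p + p) = occ p)"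

lemma period_pos: "period \<ge> 1" and occ_period2: "occ (period + period) = occ period"
  unfolding period_def using someI_ex[OF ex_period[unfolded Bex_def]] by auto

lemma occ_multiple:
  assumes "period dvd n" "n \<ge> 1"
  shows "occ n = occ period"
proof -
  have "occ (period * Suc k) = occ period" for k
  proof (induction k)
    case (Suc k)
    have "occ (period * Suc (Suc k)) = occ (period + period * Suc k)" by simp
    also have "\<dots> = occ (period + period)" by (simp only: occ_add Suc)
    finally show ?case by (simp only: occ_period2)
  qed simp
  moreover obtain k where "n = period * Suc k"
    using assms by (metis dvd_def mult_0_right not_one_le_zero not0_implies_Suc)
  ultimately show ?thesis by simp
qed

lemma occ_period_trans: "(A, B) \<in> occ period \<Longrightarrow> (B, C) \<in> occ period \<Longrightarrow> (A, C) \<in> occ period"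
  using occ_add[of period period] occ_period2 by blast

lemma occ_nonempty:
  assumes "A \<in> \<A>"
  obtains B where "(A, B) \<in> occ n"
proof -
  obtain Q where "Q \<in> infl n {A}" using infl_tile_nonempty[OF proto_copy_proto[OF assms]] by blast
  then show ?thesis using occE[OF assms] that by metis
qed

text \<open>Up to the period, these are the prototiles of the closed irreducible classes of the
  substitution matrix, on each of which \<open>\<omega> ^^ period\<close> is primitive.\<close>

definition final :: "('n, 'l) tile \<Rightarrow> bool" where
  "final D \<longleftrightarrow> D \<in> \<A> \<and> (\<forall>C. (D, C) \<in> occ period \<longrightarrow> (C, D) \<in> occ period)"

lemma final_refl: "final D \<Longrightarrow> (D, D) \<in> occ period"
  using occ_nonempty occ_period_trans unfolding final_def by metis

text \<open>Among the types reachable from \<open>A\<close>, one with the fewest successors shares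
  its successor set with every type that it reaches; all its successors are therefore final.\<close>

lemma ex_final:
  assumes "A \<in> \<A>"
  obtains D where "final D" "(A, D) \<in> occ period"
proof -
  define E where "E = (\<lambda>A. occ period `` {A})"
  have fin: "finite (E A)" for A
    by (rule finite_subset[OF _ finite_\<A>]) (auto simp: E_def dest: occ_dom)
  obtain B0 where "(A, B0) \<in> occ period" using occ_nonempty[OF assms] .
  then obtain B where B: "(A, B) \<in> occ period" "\<And>C. (A, C) \<in> occ period \<Longrightarrow> card (E B) \<le> card (E C)"
    using ex_has_least_nat[of "\<lambda>B. (A, B) \<in> occ period" B0 "\<lambda>B. card (E B)"] by blast
  have eq: "E C = E B" if "(B, C) \<in> occ period" for C
  proof -
    have "E C \<subseteq> E B" unfolding E_def using that occ_period_trans by blast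
    moreover have "card (E B) \<le> card (E C)" using B that occ_period_trans by blast
    ultimately show ?thesis using fin card_seteq by metis
  qed
  \<comment> \<open>\<open>B\<close> itself may fail to recur, as \<open>occ period\<close> need not
    be reflexive; its successors lie in the common successor set.\<close>
  obtain D where D: "(B, D) \<in> occ period" using occ_nonempty occ_dom(2)[OF B(1)] by metis
  have "(C, D) \<in> occ period" if "(D, C) \<in> occ period" for C
  proof -
    have "E C = E B" using eq occ_period_trans[OF D that] by blast
    then show ?thesis using D by (auto simp: E_def)
  qed
  then have "final D" using occ_dom(2)[OF D] by (auto simp: final_def)
  then show ?thesis using that occ_period_trans[OF B(1) D] by blast
qed

text \<open>Only multiples of \<open>period\<close> are allowed as levels, so that the cyclic
  classes of one irreducible block, which can give different minimal components, are not
  mixed.\<close>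

definition final_legal :: "('n, 'l) tile \<Rightarrow> ('n, 'l) tile set \<Rightarrow> bool" where
  "final_legal D P \<longleftrightarrow> (\<exists>n x. period dvd n \<and> 1 \<le> n \<and> shift x P \<subseteq> infl n {D})"

definition component :: "('n, 'l) tile \<Rightarrow> ('n, 'l) tile set set" where
  "component D = {T \<in> X. \<forall>P. P \<subseteq> T \<and> finite P \<longrightarrow> final_legal D P}"

lemma final_legalE:
  assumes "final_legal D P"
  obtains n x where "period dvd n" "shift x P \<subseteq> infl n {D}" "1 \<le> n"
  using assms unfolding final_legal_def by metis

lemma final_legal_subset: "final_legal D P \<Longrightarrow> Q \<subseteq> P \<Longrightarrow> final_legal D Q"
  unfolding final_legal_def by (meson image_mono subset_trans)

lemma final_legal_shift [simp]: "final_legal D (shift g P) \<longleftrightarrow> final_legal D P"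
proof -
  have "final_legal D (shift g P)" if fl: "final_legal D P" for g P
  proof -
    obtain n x where "period dvd n" "shift x P \<subseteq> infl n {D}" "1 \<le> n"
      using fl by (rule final_legalE)
    then show ?thesis unfolding final_legal_def
      by (intro exI[of _ n] exI[of _ "x - g"]) (simp add: shift_add)
  qed
  from this[of P g] this[of "shift g P" "- g"] show ?thesis
    by (auto simp: shift_add)
qed

lemma component_shift: "T \<in> component D \<Longrightarrow> shift g T \<in> component D"
proof -
  assume T: "T \<in> component D"
  have "final_legal D P" if "P \<subseteq> shift g T" "finite P" for P
  proof -
    have "shift (- g) P \<subseteq> T" using that by (simp add: shift_subset_iff)
    then have "final_legal D (shift (- g) P)" using T that by (auto simp: component_def)
    then show ?thesis by simp
  qed
  then show ?thesis using T by (auto simp: component_def)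
qed

text \<open>A final prototile recurs in its own supertiles at every positive multiple of
  \<open>period\<close>.\<close>

lemma final_mono:
  assumes D: "final D" and "period dvd M" "period dvd N" "M \<le> N"
  shows "\<exists>x. shift x (infl M {D}) \<subseteq> infl N {D}"
proof (cases "M = N")
  case True
  then show ?thesis by (intro exI[of _ 0]) simp
next
  case False
  then have "occ (N - M) = occ period" using assms by (intro occ_multiple) auto
  then have "(D, D) \<in> occ (N - M)" using final_refl[OF D] by simp
  from occ_infl[OF this, of M] show ?thesis using assms by simp
qed

section \<open>Supertiles\<close>

definition diam_bound :: "nat \<Rightarrow> real \<Rightarrow> bool" where
  "diam_bound M b \<longleftrightarrow> b > 0 \<and>
     (\<forall>T. \<forall>y\<in>(\<phi> ^^ M) ` supp T. \<forall>y'\<in>(\<phi> ^^ M) ` supp T. proto_copy T \<longrightarrow> dist y y' \<le> b)"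

lemma diam_boundD:
  assumes "diam_bound M b"
  shows "b > 0" "proto_copy T \<Longrightarrow> y \<in> (\<phi> ^^ M) ` supp T \<Longrightarrow> y' \<in> (\<phi> ^^ M) ` supp T \<Longrightarrow> dist y y' \<le> b"
  using assms unfolding diam_bound_def by blast+

lemma ex_diam_bound:
  obtains b where "diam_bound M b"
proof -
  obtain r D where rD: "r > 0" "D > 0" "\<And>T. proto_copy T \<Longrightarrow> \<exists>x. ball x r \<subseteq> supp T \<and> supp T \<subseteq> ball x D"
    using proto_copy_radii by metis
  obtain B where B: "B > 0" "\<And>x. norm ((\<phi> ^^ M) x) \<le> B * norm x"
    using linear_bounded_pos[OF lin_pow] by metis
  show ?thesis
  proof (rule that, unfold diam_bound_def, intro conjI allI ballI impI)
    show "B * (2 * D) > 0" using B rD by simp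
    fix T y y' assume T: "y \<in> (\<phi> ^^ M) ` supp T" "y' \<in> (\<phi> ^^ M) ` supp T" "proto_copy T"
    then obtain u u' where u: "y = (\<phi> ^^ M) u" "y' = (\<phi> ^^ M) u'" "u \<in> supp T" "u' \<in> supp T" by blast
    obtain x where "supp T \<subseteq> ball x D" using rD(3)[OF T(3)] by blast
    then have "dist x u < D" "dist x u' < D" using u by auto
    then have "dist u u' \<le> 2 * D" using dist_triangle[of u u' x] by (simp add: dist_commute)
    then have "B * norm (u - u') \<le> B * (2 * D)" using B by (simp add: dist_norm)
    then show "dist y y' \<le> B * (2 * D)"
      using B(2)[of "u - u'"] by (simp add: u dist_norm linear_diff[OF lin_pow])
  qed
qed

lemma patch_around_covers:
  assumes "T \<in> X" "y \<in> B"
  shows "z + y \<in> set_supp (shift z {Q \<in> T. supp Q \<inter> B \<noteq> {}})"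
proof -
  obtain Q where Q: "Q \<in> T" "y \<in> supp Q" using X_cover[OF assms(1)] by metis
  then have "y \<in> set_supp {Q \<in> T. supp Q \<inter> B \<noteq> {}}"
    using assms(2) unfolding set_supp_def by blast
  then show ?thesis unfolding set_supp_shift by blast
qed

text \<open>A patch that covers a ball wider than every supertile of level at most \<open>M\<close>
  fits only into a higher level. Differences \<open>N - M\<close> below are thereby genuine.\<close>

lemma level_large:
  obtains R where "\<And>T A z N B. T \<in> X \<Longrightarrow> A \<in> \<A> \<Longrightarrow> cball 0 R \<subseteq> B \<Longrightarrow>
    shift z {Q \<in> T. supp Q \<inter> B \<noteq> {}} \<subseteq> infl N {A} \<Longrightarrow> M < N"
proof -
  have "\<exists>b. diam_bound N b" for N using ex_diam_bound by blast
  then obtain b where b: "\<And>N. diam_bound N (b N)" by metis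
  note b0 = diam_boundD(1)[OF b]
  \<comment> \<open>The sum dominates \<open>b N\<close> for every \<open>N \<le> M\<close>; the
    extra 1 makes the final comparison strict.\<close>
  define R where "R = (\<Sum>N\<le>M. b N) + 1"
  have R0: "R \<ge> 0" unfolding R_def using b0 by (intro add_nonneg_nonneg sum_nonneg) (auto intro: less_imp_le)
  then obtain v :: "real ^ 'n" where v: "norm v = R" using vector_choose_size by blast
  show ?thesis
  proof (rule that, rule ccontr)
    fix T A z N B assume *: "T \<in> X" "A \<in> \<A>" "cball 0 R \<subseteq> B"
      "shift z {Q \<in> T. supp Q \<inter> B \<noteq> {}} \<subseteq> infl N {A}" "\<not> M < N"
    have "v \<in> B" "0 \<in> B" using *(3) v R0 by auto
    then have "z + v \<in> set_supp (infl N {A})" "z + 0 \<in> set_supp (infl N {A})"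
      using subsetD[OF set_supp_mono[OF *(4)] patch_around_covers[OF *(1)]] by metis+
    then have "dist (z + v) (z + 0) \<le> b N"
      unfolding infl_tile(2)[OF proto_copy_proto[OF *(2)]] by (rule diam_boundD(2)[OF b proto_copy_proto[OF *(2)]])
    moreover have "b N \<le> (\<Sum>N\<le>M. b N)" using b0 *(5) by (intro member_le_sum) (auto intro: less_imp_le)
    ultimately show False using v by (simp add: R_def dist_norm)
  qed
qed

text \<open>The level-\<open>M\<close> supertile over \<open>z\<close>, the image of the origin of
  \<open>T\<close>, has diameter at most \<open>b\<close>. The captured patch therefore covers it,
  and hence contains its tiles.\<close>

lemma contains_supertile:
  assumes T: "T \<in> X" and A: "A \<in> \<A>" and MN: "M \<le> N"
    and b: "diam_bound M b"
    and B: "cball 0 b \<subseteq> B" and sub: "shift z {Q \<in> T. supp Q \<inter> B \<noteq> {}} \<subseteq> infl N {A}"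
  shows "\<exists>C\<in>infl (N - M) {A}. infl M {C} \<subseteq> shift z T"
proof -
  let ?P = "{Q \<in> T. supp Q \<inter> B \<noteq> {}}"
  have N: "infl N {A} = infl M (infl (N - M) {A})" using infl_add[of M "N - M"] MN by simp
  note ptA = proto_copy_proto[OF A]
  have "0 \<in> B" using B diam_boundD(1)[OF b] by auto
  then have "z \<in> set_supp (infl N {A})" 
    using subsetD[OF set_supp_mono[OF sub] patch_around_covers[OF T, of 0]] by simp
  then have "z \<in> (\<phi> ^^ M) ` set_supp (infl (N - M) {A})"
    unfolding N infl_patch(2)[OF infl_tile(1)[OF ptA]] .
  then obtain C where C: "C \<in> infl (N - M) {A}" "z \<in> (\<phi> ^^ M) ` supp C" unfolding set_supp_def by blast
  have ptC: "proto_copy C" using infl_tileD(1)[OF ptA C(1)] .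
  have subC: "infl M {C} \<subseteq> infl N {A}" using infl_trans[OF C(1), of M] MN by simp
  have "Q \<in> shift z ?P" if Q: "Q \<in> infl M {C}" for Q
  proof (rule patch_mem[OF infl_tile(1)[OF ptA] _ sub])
    show "Q \<in> infl N {A}" using Q subC by blast
    show "supp Q \<subseteq> set_supp (shift z ?P)"
    proof
      fix y assume "y \<in> supp Q"
      then have "dist z y \<le> b" 
        using diam_boundD(2)[OF b ptC C(2)] infl_tileD(2)[OF ptC Q] by blast
      then have "y - z \<in> B" using B by (auto simp: dist_norm norm_minus_commute)
      from patch_around_covers[OF T this, of z] show "y \<in> set_supp (shift z ?P)" by simp
    qed
  qed
  then show ?thesis using C(1) by blast
qed

section \<open>Tilings containing supertiles of a given type\<close>

definition contains_level :: "('n, 'l) tile \<Rightarrow> nat \<Rightarrow> ('n, 'l) tile set \<Rightarrow> bool" where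
  "contains_level D M T \<longleftrightarrow> (\<exists>x. shift x (infl M {D}) \<subseteq> T)"

lemma contains_level_shift: "contains_level D M (shift z T) \<Longrightarrow> contains_level D M T"
proof -
  assume "contains_level D M (shift z T)"
  then obtain x where "shift x (infl M {D}) \<subseteq> shift z T" by (auto simp: contains_level_def)
  then have "shift (- z + x) (infl M {D}) \<subseteq> T" using shift_subset_iff[of "- z" "shift x (infl M {D})" T]
    by (simp add: shift_add)
  then show ?thesis by (auto simp: contains_level_def)
qed

lemma contains_level_occ:
  assumes "(C, D) \<in> occ k" "infl (M + k) {tile_shift c C} \<subseteq> T"
  shows "contains_level D M T"
proof -
  obtain x where "shift x (infl M {D}) \<subseteq> infl (M + k) {C}" using occ_infl[OF assms(1)] by blast
  then have "shift ((\<phi> ^^ (M + k)) c + x) (infl M {D}) \<subseteq> T"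
    using assms(2) unfolding infl_tile_shift shift_add[symmetric] by (meson image_mono subset_trans)
  then show ?thesis by (auto simp: contains_level_def)
qed

lemma component_contains_level:
  assumes D: "final D" and T: "T \<in> component D" and M: "period dvd M"
  shows "contains_level D M T"
proof -
  \<comment> \<open>The extra \<open>period\<close> levels leave room for the supertile found, whose
    type is a successor of \<open>D\<close>, to lead back to \<open>D\<close> by finality.\<close>
  let ?M = "M + period"
  have TX: "T \<in> X" and DA: "D \<in> \<A>" using T D by (auto simp: component_def final_def)
  obtain b where b: "diam_bound ?M b" by (rule ex_diam_bound)
  obtain R where R: "\<And>T A z N B. T \<in> X \<Longrightarrow> A \<in> \<A> \<Longrightarrow> cball 0 R \<subseteq> B \<Longrightarrow>
    shift z {Q \<in> T. supp Q \<inter> B \<noteq> {}} \<subseteq> infl N {A} \<Longrightarrow> ?M < N" using level_large[of ?M] by blast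
  define B where "B = (cball 0 (max b R) :: (real ^ 'n) set)"
  have B: "cball 0 b \<subseteq> B" "cball 0 R \<subseteq> B" "bounded B" by (auto simp: B_def)
  have "final_legal D {Q \<in> T. supp Q \<inter> B \<noteq> {}}"
    using T X_finite_meet[OF TX B(3)] by (auto simp: component_def)
  then obtain N z where N: "period dvd N" "shift z {Q \<in> T. supp Q \<inter> B \<noteq> {}} \<subseteq> infl N {D}"
    by (rule final_legalE)
  have lt: "?M < N" using R[OF TX DA B(2) N(2)] .
  obtain C where C: "C \<in> infl (N - ?M) {D}" "infl ?M {C} \<subseteq> shift z T"
    using contains_supertile[OF TX DA less_imp_le[OF lt] b B(1) N(2)] by blast
  obtain C' c where C': "(D, C') \<in> occ (N - ?M)" "C = tile_shift c C'" using occE[OF DA C(1)] by metis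
  have "occ (N - ?M) = occ period" using lt N(1) M by (intro occ_multiple) auto
  then have "(C', D) \<in> occ period" using C'(1) D unfolding final_def by blast
  from contains_level_shift[OF contains_level_occ[OF this C(2)[unfolded C'(2)]]] show ?thesis .
qed

lemma X_contains_level:
  assumes TX: "T \<in> X"
  shows "\<exists>D. final D \<and> contains_level D M T"
proof -
  let ?M = "M + period"
  obtain b where b: "diam_bound ?M b" by (rule ex_diam_bound)
  obtain R where R: "\<And>T A z N B. T \<in> X \<Longrightarrow> A \<in> \<A> \<Longrightarrow> cball 0 R \<subseteq> B \<Longrightarrow>
    shift z {Q \<in> T. supp Q \<inter> B \<noteq> {}} \<subseteq> infl N {A} \<Longrightarrow> ?M < N" using level_large[of ?M] by blast
  define B where "B = (cball 0 (max b R) :: (real ^ 'n) set)"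
  have B: "cball 0 b \<subseteq> B" "cball 0 R \<subseteq> B" "bounded B" by (auto simp: B_def)
  obtain z N A where N: "A \<in> \<A>" "shift z {Q \<in> T. supp Q \<inter> B \<noteq> {}} \<subseteq> infl N {A}"
    by (rule X_capture[OF TX B(3)])
  have lt: "?M < N" using R[OF TX N(1) B(2) N(2)] .
  obtain C where C: "C \<in> infl (N - ?M) {A}" "infl ?M {C} \<subseteq> shift z T"
    using contains_supertile[OF TX N(1) less_imp_le[OF lt] b B(1) N(2)] by blast
  obtain C' c where C': "(A, C') \<in> occ (N - ?M)" "C = tile_shift c C'" using occE[OF N(1) C(1)] by metis
  obtain D where D: "final D" "(C', D) \<in> occ period" using ex_final occ_dom(2)[OF C'(1)] by metis
  from contains_level_shift[OF contains_level_occ[OF D(2) C(2)[unfolded C'(2)]]] D(1)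
  show ?thesis by blast
qed

lemma contains_level_mono:
  assumes "final D" "contains_level D N T" "period dvd M" "period dvd N" "M \<le> N"
  shows "contains_level D M T"
proof -
  obtain x where "shift x (infl M {D}) \<subseteq> infl N {D}" using final_mono[OF assms(1,3,4,5)] by blast
  moreover obtain y where "shift y (infl N {D}) \<subseteq> T" using assms(2) by (auto simp: contains_level_def)
  ultimately have "shift y (shift x (infl M {D})) \<subseteq> T" by (meson image_mono subset_trans)
  then show ?thesis unfolding contains_level_def shift_add by blast
qed

text \<open>\<open>X_contains_level\<close> may give a different final type for each level. There
  are finitely many types, and a type that occurs at one multiple of \<open>period\<close> occurs at
  all smaller ones, so a single type serves all levels.\<close>

lemma X_contains_all_levels:
  assumes "T \<in> X"
  shows "\<exists>D. final D \<and> (\<forall>M. period dvd M \<longrightarrow> contains_level D M T)"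
proof (rule ccontr)
  assume "\<not> ?thesis"
  then obtain m where m: "\<And>D. final D \<Longrightarrow> period dvd m D \<and> \<not> contains_level D (m D) T" by metis
  have fin: "finite {D. final D}" by (rule finite_subset[OF _ finite_\<A>]) (auto simp: final_def)
  \<comment> \<open>A multiple of \<open>period\<close> that is at least every level
    \<open>m D\<close> at which a type fails.\<close>
  define N where "N = period * (\<Sum>D\<in>{D. final D}. m D)"
  obtain D where D: "final D" "contains_level D N T" using X_contains_level[OF assms] by blast
  have "m D \<le> (\<Sum>D\<in>{D. final D}. m D)" using fin D by (intro member_le_sum) auto
  also have "\<dots> \<le> N" using period_pos by (simp add: N_def)
  finally have "m D \<le> N" .
  moreover have "period dvd N" by (simp add: N_def)
  ultimately have "contains_level D (m D) T"
    using m[OF D(1)] by (intro contains_level_mono[OF D(1,2)]) auto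
  then show False using m[OF D(1)] by blast
qed


section \<open>Closedness, nonemptiness and minimality of the components\<close>

text \<open>A nearby tiling contains a small translate of the patch, and compactness of its support
  leaves room to move inside \<open>W\<close>. With \<open>W\<close> the whole space this gives
  closedness of the components, with a ball openness of \<open>bad_near\<close>.\<close>

lemma openin_patch_condition:
  assumes inv: "\<And>g P. bad P \<Longrightarrow> bad (shift g P)" and W: "open W"
  shows "openin (tiling_topology X) {T \<in> X. \<exists>P\<subseteq>T. finite P \<and> set_supp P \<subseteq> W \<and> bad P}" (is "openin _ ?U")
  unfolding openin_tiling_topology
proof (intro conjI ballI)
  show "?U \<subseteq> X" by blast
  fix T assume "T \<in> ?U"
  then obtain P where T: "T \<in> X" and P: "P \<subseteq> T" "finite P" "set_supp P \<subseteq> W" "bad P" by blast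
  have "compact (supp Q)" if "Q \<in> P" for Q
    using X_proto_copy[OF T] proto_copy_is_tile P(1) that unfolding is_tile_def by blast
  then have cpt: "compact (set_supp P)" unfolding set_supp_def by (intro compact_UN P(2))
  obtain \<eta> where \<eta>: "\<eta> > 0" "(\<Union>x\<in>set_supp P. ball x \<eta>) \<subseteq> W"
    using compact_subset_open_imp_ball_epsilon_subset[OF cpt W P(3)] by metis
  obtain b where b: "b > 0" "set_supp P \<subseteq> ball 0 b"
    using bounded_subset_ballD[OF compact_imp_bounded[OF cpt], of 0] by blast
  \<comment> \<open>The four bounds exclude the default distance, keep \<open>norm g < 1\<close>,
    keep the moved patch in \<open>W\<close>, and make the ball of agreement reach radius
    \<open>b + 1\<close>.\<close>
  define \<epsilon> where "\<epsilon> = min (min (2 powr (- 1 / 2)) 1) (min \<eta> (1 / (b + 1)))"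
  have e: "\<epsilon> > 0" "\<epsilon> \<le> 2 powr (- 1 / 2)" "\<epsilon> \<le> 1" "\<epsilon> \<le> \<eta>" "\<epsilon> \<le> 1 / (b + 1)"
    using \<eta>(1) b(1) by (auto simp: \<epsilon>_def)
  have "V \<in> ?U" if V: "V \<in> X" "tiling_dist T V < \<epsilon>" for V
  proof -
    obtain r g where r: "0 < r" "r < \<epsilon>" "norm g \<le> r" "ball 0 (1 / r) \<subseteq> set_supp (shift (- g) T \<inter> V)"
      using tiling_dist_lessE[OF V(2) e(2)] by metis
    have small: "norm g < 1" "norm g < \<eta>" using r e by linarith+
    have "r < 1 / (b + 1)" using r e by linarith
    then have "b + 1 < 1 / r" using r(1) b(1) by (simp add: field_simps)
    have "set_supp (shift (- g) P) \<subseteq> ball 0 (1 / r)"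
    proof
      fix y assume "y \<in> set_supp (shift (- g) P)"
      then obtain x where x: "x \<in> set_supp P" "y = - g + x" unfolding set_supp_shift by blast
      have "norm x < b" using b(2) x(1) by auto
      then show "y \<in> ball 0 (1 / r)"
        using norm_triangle_ineq[of "- g" x] small \<open>b + 1 < 1 / r\<close> x(2) by simp
    qed
    then have cov: "set_supp (shift (- g) P) \<subseteq> set_supp (shift (- g) T \<inter> V)" using r(4) by blast
    have gT: "shift (- g) T \<in> X" using T by simp
    have "Q \<in> shift (- g) T \<inter> V" if Q: "Q \<in> shift (- g) P" for Q
    proof (rule nonoverlapping_mem)
      show "nonoverlapping (shift (- g) T)" using gT by (simp only: tiling_space_def is_tiling_def mem_Collect_eq)
      show "is_tile T'" if "T' \<in> shift (- g) T" for T' using X_proto_copy[OF gT that] by (rule proto_copy_is_tile)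
      show "Q \<in> shift (- g) T" using Q P(1) by blast
      show "supp Q \<subseteq> set_supp (shift (- g) T \<inter> V)" using cov Q unfolding set_supp_def by blast
    qed blast
    then have "shift (- g) P \<subseteq> V" by blast
    moreover have "set_supp (shift (- g) P) \<subseteq> W"
    proof
      fix y assume "y \<in> set_supp (shift (- g) P)"
      then obtain x where x: "x \<in> set_supp P" "y = - g + x" unfolding set_supp_shift by blast
      then have "y \<in> ball x \<eta>" using small(2) by (simp add: dist_norm)
      then show "y \<in> W" using \<eta>(2) x(1) by blast
    qed
    moreover have "finite (shift (- g) P)" "bad (shift (- g) P)" using P inv by auto
    ultimately show ?thesis using V(1) by blast
  qed
  then show "\<exists>\<epsilon>>0. {S \<in> X. tiling_dist T S < \<epsilon>} \<subseteq> ?U" using e(1) by blast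
qed

lemma closedin_component: "closedin (tiling_topology X) (component D)"
proof -
  have "X - component D = {T \<in> X. \<exists>P\<subseteq>T. finite P \<and> set_supp P \<subseteq> UNIV \<and> \<not> final_legal D P}"
    by (auto simp: component_def)
  then have "openin (tiling_topology X) (X - component D)"
    using openin_patch_condition[of "\<lambda>P. \<not> final_legal D P" UNIV] by simp
  then show ?thesis by (auto simp: closedin_def component_def)
qed

lemma closedin_closure_of_subtopology:
  assumes "closedin \<T> Y" "S \<subseteq> Y"
  shows "subtopology \<T> Y closure_of S = \<T> closure_of S"
  using assms closure_of_minimal[OF assms(2,1)] by (simp add: closure_of_subtopology Int_absorb1)

text \<open>A patch of \<open>S\<close> lies in a supertile of type \<open>D\<close>, and
  \<open>T\<close> contains that supertile, so a translate of \<open>T\<close> agrees with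
  \<open>S\<close> on the patch. The hypothesis on supertiles is what is available for a tiling of
  an arbitrary minimal component.\<close>

lemma component_subset_orbit_closure:
  assumes D: "final D" and T: "T \<in> X" and cl: "\<And>M. period dvd M \<Longrightarrow> contains_level D M T"
  shows "component D \<subseteq> tiling_topology X closure_of orbit T"
proof
  fix S assume S: "S \<in> component D"
  then have SX: "S \<in> X" by (simp add: component_def)
  show "S \<in> tiling_topology X closure_of orbit T"
    unfolding in_closure_of
  proof (intro conjI allI impI)
    show "S \<in> topspace (tiling_topology X)" using SX by simp
    fix U assume "S \<in> U \<and> openin (tiling_topology X) U"
    then obtain e where e: "e > 0" "{V \<in> X. tiling_dist S V < e} \<subseteq> U"
      unfolding openin_tiling_topology by blast
    define r where "r = min (e / 2) (2 powr (- 1 / 2) / 2)"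
    have r: "0 < r" "r < e" "r < 2 powr (- 1 / 2)" using e(1) by (auto simp: r_def min_less_iff_disj)
    let ?P = "{Q \<in> S. supp Q \<inter> ball 0 (1 / r) \<noteq> {}}"
    have "finite ?P" by (rule X_finite_meet[OF SX bounded_ball])
    then have "final_legal D ?P" using S by (auto simp: component_def)
    then obtain n x where n: "period dvd n" "shift x ?P \<subseteq> infl n {D}" by (rule final_legalE)
    obtain y where y: "shift y (infl n {D}) \<subseteq> T" using cl[OF n(1)] unfolding contains_level_def by metis
    have "shift (y + x) ?P \<subseteq> T"
      using subset_trans[OF image_mono[OF n(2)] y] by (simp only: shift_add)
    then have sub: "?P \<subseteq> shift (- (y + x)) T" by (simp only: shift_subset_iff)
    let ?V = "shift (- (y + x)) T"
    have "ball 0 (1 / r) \<subseteq> set_supp (S \<inter> ?V)"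
    proof
      fix u :: "real ^ 'n" assume u: "u \<in> ball 0 (1 / r)"
      have "u \<in> set_supp ?P" using patch_around_covers[OF SX u, of 0] by simp
      moreover have "?P \<subseteq> S \<inter> ?V" using sub by blast
      ultimately show "u \<in> set_supp (S \<inter> ?V)" using set_supp_mono by blast
    qed
    then have "tiling_dist S ?V \<le> r" using tiling_dist_le r by blast
    then have "tiling_dist S ?V < e" using r(2) by linarith
    then have "?V \<in> U" using e(2) X_shift[OF T, of "- (y + x)"] by blast
    then show "\<exists>V. V \<in> orbit T \<and> V \<in> U" unfolding orbit_def by blast
  qed
qed

lemma orbit_subset_component: "T \<in> component D \<Longrightarrow> orbit T \<subseteq> component D"
  unfolding orbit_def using component_shift by (intro image_subsetI)

lemma component_orbit_closure:
  assumes D: "final D" and T: "T \<in> component D"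
  shows "tiling_topology X closure_of orbit T = component D"
proof (rule subset_antisym)
  show "tiling_topology X closure_of orbit T \<subseteq> component D"
    using closure_of_minimal[OF orbit_subset_component[OF T] closedin_component] .
  have "T \<in> X" using T by (simp add: component_def)
  then show "component D \<subseteq> tiling_topology X closure_of orbit T"
    using component_subset_orbit_closure[OF D] component_contains_level[OF D T] by blast
qed

section \<open>Deep subtiles and the existence of tilings in a component\<close>

lemma ex_deep_subtile:
  "\<exists>j. period dvd j \<and> 1 \<le> j \<and>
    (\<forall>C. proto_copy C \<longrightarrow> (\<exists>Q\<in>infl j {C}. (\<Union>y\<in>supp Q. ball y 1) \<subseteq> (\<phi> ^^ j) ` supp C))"
proof -
  obtain r D where rD: "r > 0" "D > 0" "\<And>T. proto_copy T \<Longrightarrow> \<exists>x. ball x r \<subseteq> supp T \<and> supp T \<subseteq> ball x D"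
    using proto_copy_radii by metis
  \<comment> \<open>A point within 1 of a tile through the image of the centre \<open>c\<close> is
    less than \<open>2 * D + 1\<close> from that image; \<open>e\<close> pulls this distance back to
    the inner radius \<open>r\<close>.\<close>
  define e where "e = r / (2 * D + 1)"
  have e: "e > 0" "e * (2 * D + 1) = r" using rD by (auto simp: e_def)
  obtain N where N: "\<forall>n\<ge>N. \<forall>x. norm x \<le> e * norm ((\<phi> ^^ n) x)"
    using expansive_eventually_large[OF expansive e(1)] by blast
  define j where "j = period * (N + 1)"
  have "1 * (N + 1) \<le> j" unfolding j_def using period_pos by (rule mult_right_mono) simp
  then have j: "period dvd j" "1 \<le> j" "N \<le> j" by (auto simp: j_def)
  have "\<exists>Q\<in>infl j {C}. (\<Union>y\<in>supp Q. ball y 1) \<subseteq> (\<phi> ^^ j) ` supp C" if C: "proto_copy C" for C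
  proof -
    obtain c where c: "ball c r \<subseteq> supp C" using rD(3)[OF C] by blast
    have "c \<in> supp C" using c rD(1) by auto
    then have "(\<phi> ^^ j) c \<in> set_supp (infl j {C})" unfolding infl_tile(2)[OF C] by blast
    then obtain Q where Q: "Q \<in> infl j {C}" "(\<phi> ^^ j) c \<in> supp Q" unfolding set_supp_def by blast
    obtain q where q: "supp Q \<subseteq> ball q D" using rD(3)[OF infl_tileD(1)[OF C Q(1)]] by blast
    have "w \<in> (\<phi> ^^ j) ` supp C" if y: "y \<in> supp Q" "w \<in> ball y 1" for y w
    proof -
      obtain v where v: "w = (\<phi> ^^ j) v" using surj_pow[of j] by (meson surjE)
      have "dist q y < D" "dist q ((\<phi> ^^ j) c) < D" "dist y w < 1" using q y Q(2) by auto
      then have "dist w ((\<phi> ^^ j) c) < 2 * D + 1" by metric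
      then have "e * norm ((\<phi> ^^ j) (v - c)) < r"
        using e by (metis dist_norm linear_diff[OF lin_pow] mult_strict_left_mono v)
      then have "norm (v - c) < r" using N j(3) le_less_trans by blast
      then have "v \<in> supp C" using c by (auto simp: dist_norm norm_minus_commute)
      then show ?thesis using v by blast
    qed
    then show ?thesis using Q(1) by blast
  qed
  then show ?thesis using j by blast
qed

text \<open>A translate \<open>T0\<close> of \<open>D\<close> with
  \<open>T0 \<in> infl n {T0}\<close> makes the patches \<open>infl (n * i) {T0}\<close> increase,
  and their union is the tiling. It fills space because 0 turns out to be interior to the support of
  one of them.\<close>

lemma component_nonempty:
  assumes D: "final D"
  shows "component D \<noteq> {}"
proof -
  have DA: "D \<in> \<A>" using D by (simp only: final_def)
  obtain j where j: "period dvd j" "1 \<le> j"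
    "\<And>C. proto_copy C \<Longrightarrow> \<exists>Q\<in>infl j {C}. (\<Union>y\<in>supp Q. ball y 1) \<subseteq> (\<phi> ^^ j) ` supp C"
    using ex_deep_subtile by blast
  obtain Q' where Q': "Q' \<in> infl j {D}" "(\<Union>y\<in>supp Q'. ball y 1) \<subseteq> (\<phi> ^^ j) ` supp D"
    using j(3)[OF proto_copy_proto[OF DA]] by blast
  have intQ': "supp Q' \<subseteq> (\<phi> ^^ j) ` interior (supp D)"
    unfolding interior_pow[symmetric]
    by (rule interior_maximal[THEN subset_trans[rotated]])
      (use Q'(2) in \<open>auto intro!: open_UN\<close>)
  obtain B b where B: "(D, B) \<in> occ j" "Q' = tile_shift b B" using occE[OF DA Q'(1)] by metis
  then have "(B, D) \<in> occ period" using D occ_multiple[OF j(1,2)] unfolding final_def by blast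
  then obtain x where x: "tile_shift x D \<in> infl period {B}" unfolding occ_def by blast
  define n where "n = period + j"
  have n: "1 \<le> n" "period dvd n" using j by (auto simp: n_def)
  define q where "q = (\<phi> ^^ period) b + x"
  have Q: "tile_shift q D \<in> infl period {Q'}"
    unfolding B(2) infl_tile_shift q_def using x by (metis imageI tile_shift_add)
  then have qn: "tile_shift q D \<in> infl n {D}" unfolding n_def using infl_trans[OF Q'(1)] by blast
  have "supp (tile_shift q D) \<subseteq> (\<phi> ^^ period) ` supp Q'"
    by (rule infl_tileD(2)[OF infl_tileD(1)[OF proto_copy_proto[OF DA] Q'(1)] Q])
  also have "\<dots> \<subseteq> (\<phi> ^^ period) ` (\<phi> ^^ j) ` interior (supp D)" by (rule image_mono[OF intQ'])
  also have "\<dots> = (\<phi> ^^ n) ` interior (supp D)" by (simp add: n_def funpow_add image_comp)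
  finally have intq: "(+) q ` supp D \<subseteq> (\<phi> ^^ n) ` interior (supp D)" by (simp only: supp_tile_shift)
  have large: "\<exists>i. \<forall>y. norm y \<le> e * norm ((\<phi> ^^ (n * i)) y)" if e: "e > 0" for e
  proof -
    obtain N where N: "\<forall>m\<ge>N. \<forall>y. norm y \<le> e * norm ((\<phi> ^^ m) y)"
      using expansive_eventually_large[OF expansive e] by blast
    have "N \<le> n * N" using n(1) by simp
    then show ?thesis using N by blast
  qed
  \<comment> \<open>A fixed vector of \<open>\<phi> ^^ n\<close> would have a bounded orbit, against
    expansion, so the identity minus \<open>\<phi> ^^ n\<close> is surjective. Moving
    \<open>D\<close> by the solution \<open>y\<close> turns its copy at \<open>q\<close> into
    \<open>T0\<close> itself.\<close>
  obtain y where y: "(\<phi> ^^ n) y + q = y"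
  proof -
    define f where "f = (\<lambda>y. y - (\<phi> ^^ n) y)"
    have linf: "linear f" unfolding f_def by (intro linear_compose_sub linear_ident lin_pow)
    have "y = 0" if "f y = 0" for y
    proof -
      have fix1: "(\<phi> ^^ n) y = y" using that by (simp add: f_def)
      have "(\<phi> ^^ (n * i)) y = y" for i
        by (induction i) (auto simp: funpow_add fix1)
      then have "norm y \<le> 1 / 2 * norm y" using large[of "1 / 2"] by (metis half_gt_zero zero_less_one)
      then show ?thesis by simp
    qed
    then have "surj f" using linear_inj_imp_surj[OF linf] linear_injective_0[OF linf] by blast
    then obtain y where "q = f y" by (rule surjE)
    then have "(\<phi> ^^ n) y + q = y" by (simp only: f_def) simp
    then show ?thesis by (rule that)
  qed
  define T0 where "T0 = tile_shift y D"
  define K where "K = supp T0"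
  have pt0: "proto_copy T0" using DA by (auto simp: T0_def)
  have "tile_shift ((\<phi> ^^ n) y) (tile_shift q D) \<in> infl n {T0}"
    unfolding T0_def infl_tile_shift using qn by blast
  then have T0: "T0 \<in> infl n {T0}" by (simp add: tile_shift_add y T0_def)
  have "K = (+) ((\<phi> ^^ n) y) ` (+) q ` supp D"
    unfolding K_def T0_def by (simp add: supp_tile_shift image_image add.assoc[symmetric] y)
  also have "\<dots> \<subseteq> (+) ((\<phi> ^^ n) y) ` (\<phi> ^^ n) ` interior (supp D)" by (rule image_mono[OF intq])
  also have "\<dots> = (\<phi> ^^ n) ` interior K"
    unfolding K_def T0_def by (simp only: supp_tile_shift interior_translation pow_translation)
  finally have Kint: "K \<subseteq> (\<phi> ^^ n) ` interior K" .
  then have Kn: "K \<subseteq> (\<phi> ^^ n) ` K" using interior_subset by blast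
  have Ki: "K \<subseteq> (\<phi> ^^ (n * i)) ` K" for i
  proof (induction i)
    case (Suc i)
    have "(\<phi> ^^ (n * i)) ` K \<subseteq> (\<phi> ^^ (n * i)) ` (\<phi> ^^ n) ` K" by (rule image_mono[OF Kn])
    also have "\<dots> = (\<phi> ^^ (n * Suc i)) ` K"
      by (simp add: image_comp funpow_add[symmetric] add.commute)
    finally show ?case using Suc by blast
  qed simp
  have K: "compact K" "K \<noteq> {}" using proto_copy_is_tile[OF pt0] by (auto simp: K_def is_tile_def)
  then obtain a where a: "a \<in> K" by blast
  have frac: "e / (t + 1) * t < e" if "e > 0" "t \<ge> 0" for e t :: real
  proof -
    have "e / (t + 1) * t < e / (t + 1) * (t + 1)"
      using that by (intro mult_strict_left_mono divide_pos_pos) auto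
    then show ?thesis using that by simp
  qed
  \<comment> \<open>The point \<open>a\<close> has preimages in \<open>K\<close> under all powers of
    \<open>\<phi> ^^ n\<close>, and these tend to the fixed point 0.\<close>
  have "0 \<in> closure K" unfolding closure_approachable
  proof (intro allI impI)
    fix e :: real assume "e > 0"
    then have "e / (norm a + 1) > 0" by (intro divide_pos_pos) (auto intro: add_nonneg_pos)
    then obtain i where i: "\<forall>y. norm y \<le> e / (norm a + 1) * norm ((\<phi> ^^ (n * i)) y)" using large by blast
    obtain v where v: "v \<in> K" "a = (\<phi> ^^ (n * i)) v" using Ki[of i] a by blast
    have "norm v \<le> e / (norm a + 1) * norm a" using i v(2) by blast
    also have "\<dots> < e" by (rule frac[OF \<open>e > 0\<close> norm_ge_zero])
    finally show "\<exists>v\<in>K. dist v 0 < e" using v(1) by auto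
  qed
  then have "0 \<in> K" using K(1) by (simp add: compact_imp_closed)
  then have "0 \<in> (\<phi> ^^ n) ` interior K" using Kint by blast
  then obtain r where r: "r > 0" "ball 0 r \<subseteq> (\<phi> ^^ n) ` K"
    by (metis interior_pow mem_interior)
  define F where "F = (\<lambda>i. infl (n * i) {T0})"
  have step: "F i \<subseteq> F (Suc i)" for i
    unfolding F_def using infl_trans[OF T0, of "n * i"] by (simp add: add.commute)
  have mono: "mono F" by (intro mono_iff_le_Suc[THEN iffD2] allI step)
  define T where "T = (\<Union>i. F i)"
  have Fp: "F i \<in> patches_over \<A>" "set_supp (F i) = (\<phi> ^^ (n * i)) ` K" for i
    unfolding F_def K_def using infl_tile[OF pt0] by blast+
  \<comment> \<open>\<open>Suc i\<close> rather than \<open>i\<close>, because legality asks for a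
    positive level.\<close>
  have patch: "\<exists>i. P \<subseteq> F (Suc i)" if "P \<subseteq> T" "finite P" for P
    using finite_subset_UN_mono[OF that(2) that(1)[unfolded T_def] mono] step by blast
  have "set_supp T = UNIV"
  proof -
    have "u \<in> set_supp T" for u
    proof -
      have "r / (norm u + 1) > 0" using r(1) by (intro divide_pos_pos) (auto intro: add_nonneg_pos)
      then obtain i where i: "\<forall>y. norm y \<le> r / (norm u + 1) * norm ((\<phi> ^^ (n * i)) y)" using large by blast
      obtain v where v: "u = (\<phi> ^^ (n * i)) v" using surj_pow by (meson surjE)
      have "norm v \<le> r / (norm u + 1) * norm u" using i v by blast
      also have "\<dots> < r" by (rule frac[OF r(1) norm_ge_zero])
      finally have "v \<in> (\<phi> ^^ n) ` K" using r(2) by auto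
      then have "u \<in> (\<phi> ^^ (n * i)) ` (\<phi> ^^ n) ` K" using v by blast
      then have "u \<in> set_supp (F (Suc i))"
        unfolding Fp(2) by (simp add: image_comp funpow_add[symmetric] add.commute)
      then show ?thesis using set_supp_mono[of "F (Suc i)" T] unfolding T_def by blast
    qed
    then show ?thesis by blast
  qed
  moreover have "\<forall>Q\<in>T. is_tile Q"
    unfolding T_def using Fp(1) proto_copy_is_tile by (auto simp only: patches_over_iff UN_iff)
  moreover have "nonoverlapping T"
    unfolding nonoverlapping_def pairwise_def
  proof (intro ballI impI)
    fix Q Q' assume Q: "Q \<in> T" "Q' \<in> T" "Q \<noteq> Q'"
    then obtain i where "{Q, Q'} \<subseteq> F (Suc i)" using patch[of "{Q, Q'}"] by blast
    then show "interior (supp Q) \<inter> interior (supp Q') = {}"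
      using Fp(1)[of "Suc i"] Q(3) unfolding patches_over_iff nonoverlapping_def pairwise_def by blast
  qed
  ultimately have tiling: "is_tiling T" unfolding is_tiling_def by blast
  have sub: "\<exists>m x. period dvd m \<and> 1 \<le> m \<and> shift x P \<subseteq> infl m {D} \<and> is_patch P"
    if P: "P \<subseteq> T" "finite P" for P
  proof -
    obtain i where i: "P \<subseteq> F (Suc i)" using patch[OF P] by blast
    let ?m = "n * Suc i"
    have "P \<subseteq> shift ((\<phi> ^^ ?m) y) (infl ?m {D})"
      using i unfolding F_def T0_def infl_tile_shift .
    then have "shift (- (\<phi> ^^ ?m) y) P \<subseteq> infl ?m {D}" by (simp only: shift_subset_iff minus_minus)
    moreover have "is_patch P"
      using is_patch_subset[OF _ i] Fp(1)[of "Suc i"] unfolding patches_over_def by blast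
    moreover have "period dvd ?m" "1 \<le> ?m" using n by auto
    ultimately show ?thesis by blast
  qed
  have "legal \<phi> \<A> \<omega> P" if "P \<subseteq> T \<and> finite P" for P
    using sub that DA unfolding legal_def by meson
  then have "T \<in> X" using tiling by (simp add: tiling_space_def)
  moreover have "final_legal D P" if "P \<subseteq> T \<and> finite P" for P
    using sub that unfolding final_legal_def by meson
  ultimately have "T \<in> component D" by (simp add: component_def)
  then show ?thesis by blast
qed

text \<open>For the converse, a tiling of \<open>Y\<close> has supertiles of all levels of one final
  type \<open>D\<close>, so its orbit closure \<open>Y\<close> contains \<open>component D\<close>.
  The orbit closure of a tiling in \<open>component D\<close> is then equal to both sets.\<close>

lemma minimal_component_iff: "minimal_component X Y \<longleftrightarrow> (\<exists>D. final D \<and> Y = component D)"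
proof
  assume "\<exists>D. final D \<and> Y = component D"
  then obtain D where D: "final D" "Y = component D" by blast
  have "subtopology (tiling_topology X) Y closure_of orbit T = Y" if "T \<in> Y" for T
    using closedin_closure_of_subtopology[OF closedin_component orbit_subset_component] component_orbit_closure[OF D(1)] that
    unfolding D(2) by blast
  then show "minimal_component X Y"
    unfolding minimal_component_def
    using component_nonempty[OF D(1)] closedin_component component_shift D(2) by blast
next
  assume Y: "minimal_component X Y"
  then have cY: "closedin (tiling_topology X) Y" and "Y \<noteq> {}"
    and inv: "\<And>T g. T \<in> Y \<Longrightarrow> shift (- g) T \<in> Y"
    and dense: "\<And>T. T \<in> Y \<Longrightarrow> subtopology (tiling_topology X) Y closure_of orbit T = Y"
    unfolding minimal_component_def by blast+
  obtain T where T: "T \<in> Y" using \<open>Y \<noteq> {}\<close> by blast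
  have YX: "Y \<subseteq> X" using closedin_subset[OF cY] by simp
  have orb: "orbit T \<subseteq> Y" if "T \<in> Y" for T unfolding orbit_def using inv[OF that] by blast
  have cl: "tiling_topology X closure_of orbit T = Y" if "T \<in> Y" for T
    using dense[OF that] closedin_closure_of_subtopology[OF cY orb[OF that]] by simp
  obtain D where D: "final D" "\<forall>M. period dvd M \<longrightarrow> contains_level D M T"
    using X_contains_all_levels T YX by blast
  have sub: "component D \<subseteq> Y"
    using component_subset_orbit_closure[OF D(1)] D(2) T YX cl[OF T] by blast
  obtain S where S: "S \<in> component D" using component_nonempty[OF D(1)] by blast
  have "Y = component D" using component_orbit_closure[OF D(1) S] cl sub S by blast
  then show "\<exists>D. final D \<and> Y = component D" using D(1) by blast
qed


section \<open>Deep subtiles and the region outside them\<close>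

definition depth :: nat where
  "depth = (SOME j. period dvd j \<and> 1 \<le> j \<and>
    (\<forall>C. proto_copy C \<longrightarrow> (\<exists>Q\<in>infl j {C}. (\<Union>y\<in>supp Q. ball y 1) \<subseteq> (\<phi> ^^ j) ` supp C)))"

lemma depth: "period dvd depth" "1 \<le> depth"
  "proto_copy C \<Longrightarrow> \<exists>Q\<in>infl depth {C}. (\<Union>y\<in>supp Q. ball y 1) \<subseteq> (\<phi> ^^ depth) ` supp C"
  using someI_ex[OF ex_deep_subtile] unfolding depth_def[symmetric] by blast+

text \<open>\<open>period\<close> levels to reach a final type, then \<open>depth\<close> more to
  place a tile well inside it.\<close>

definition stage :: nat where
  "stage = depth + period"

lemma period_dvd_stage: "period dvd stage"
  using depth(1) by (simp add: stage_def)

definition deep :: "('n, 'l) tile \<Rightarrow> ('n, 'l) tile set" where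
  "deep T = {Q. \<exists>D c. final D \<and> tile_shift c D \<in> infl period {T} \<and> Q \<in> infl depth {tile_shift c D} \<and>
     (\<Union>y\<in>supp Q. ball y 1) \<subseteq> (\<phi> ^^ depth) ` supp (tile_shift c D)}"

definition shallow :: "('n, 'l) tile \<Rightarrow> ('n, 'l) tile set" where
  "shallow T = infl stage {T} - deep T"

text \<open>What is left of a supertile after \<open>k\<close> stages of removing deep subtiles, as
  in a Cantor set, followed by \<open>K\<close> levels of plain inflation. Being a union of closed
  sets, it may keep boundary points of deep tiles.\<close>

primrec region :: "nat \<Rightarrow> nat \<Rightarrow> ('n, 'l) tile \<Rightarrow> (real ^ 'n) set" where
  "region K 0 T = (\<phi> ^^ K) ` supp T"
| "region K (Suc k) T = (\<Union>Q\<in>shallow T. region K k Q)"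

text \<open>Interiors are measured so that the volumes of the tiles of a patch add, whatever the
  measure of their boundaries.\<close>

definition vol :: "nat \<Rightarrow> ('n, 'l) tile \<Rightarrow> real" where
  "vol M T = measure lebesgue ((\<phi> ^^ M) ` interior (supp T))"

lemma final_proto_copy: "final D \<Longrightarrow> proto_copy (tile_shift c D)"
  unfolding final_def using proto_copy_proto by (simp only: proto_copy_tile_shift)

lemma deep_nonempty:
  assumes "proto_copy T"
  shows "\<exists>Q. Q \<in> infl stage {T} \<and> Q \<in> deep T"
proof -
  obtain A x where A: "A \<in> \<A>" "T = tile_shift x A" using assms unfolding proto_copy_def by blast
  obtain D where D: "final D" "(A, D) \<in> occ period" by (rule ex_final[OF A(1)])
  obtain y where "tile_shift y D \<in> infl period {A}" using D(2) unfolding occ_def by blast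
  then have c: "tile_shift ((\<phi> ^^ period) x + y) D \<in> infl period {T}"
    unfolding A(2) infl_tile_shift by (metis imageI tile_shift_add)
  obtain Q where Q: "Q \<in> infl depth {tile_shift ((\<phi> ^^ period) x + y) D}"
    "(\<Union>y\<in>supp Q. ball y 1) \<subseteq> (\<phi> ^^ depth) ` supp (tile_shift ((\<phi> ^^ period) x + y) D)"
    using depth(3)[OF final_proto_copy[OF D(1)]] by blast
  have "Q \<in> infl stage {T}" unfolding stage_def using infl_trans[OF c] Q(1) by blast
  then show ?thesis unfolding deep_def using D(1) c Q by blast
qed

lemma pow_supp_lmeasurable:
  assumes "proto_copy T"
  shows "(\<phi> ^^ M) ` supp T \<in> lmeasurable" "(\<phi> ^^ M) ` interior (supp T) \<in> lmeasurable"
proof -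
  have c: "compact ((\<phi> ^^ M) ` supp T)"
    using proto_copy_is_tile[OF assms] by (intro compact_pow) (simp add: is_tile_def)
  then show "(\<phi> ^^ M) ` supp T \<in> lmeasurable" by (rule lmeasurable_compact)
  show "(\<phi> ^^ M) ` interior (supp T) \<in> lmeasurable"
    unfolding interior_pow[symmetric] using compact_imp_bounded[OF c] by (rule lmeasurable_interior)
qed

lemma sum_vol_le:
  assumes P: "P \<in> patches_over \<A>" and S: "S \<in> lmeasurable"
    and sub: "\<And>Q. Q \<in> P \<Longrightarrow> (\<phi> ^^ M) ` interior (supp Q) \<subseteq> S"
  shows "(\<Sum>Q\<in>P. vol M Q) \<le> measure lebesgue S"
proof -
  have fin: "finite P" and proto_copy: "\<And>Q. Q \<in> P \<Longrightarrow> proto_copy Q" and no: "nonoverlapping P"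
    using P unfolding patches_over_iff by blast+
  have disj: "pairwise (\<lambda>Q Q'. disjnt ((\<phi> ^^ M) ` interior (supp Q)) ((\<phi> ^^ M) ` interior (supp Q'))) P"
    using no unfolding nonoverlapping_def pairwise_def disjnt_def image_Int[OF inj_pow, symmetric]
    by (metis image_empty)
  have "(\<Sum>Q\<in>P. vol M Q) = measure lebesgue (\<Union>Q\<in>P. (\<phi> ^^ M) ` interior (supp Q))"
    unfolding vol_def using pow_supp_lmeasurable(2)[OF proto_copy] fin disj
    by (intro measure_UNION'[symmetric]) auto
  also have "\<dots> \<le> measure lebesgue S"
  proof (rule measure_mono_fmeasurable[OF _ _ S])
    show "(\<Union>Q\<in>P. (\<phi> ^^ M) ` interior (supp Q)) \<in> sets lebesgue"
      using fin pow_supp_lmeasurable(2)[OF proto_copy] by (intro sets.finite_UN fmeasurableD)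
  qed (use sub in blast)
  finally show ?thesis .
qed

text \<open>Covering by translates of a small ball makes volumes comparable uniformly in \<open>M\<close>.  It replaces
  both the scaling of volume by \<open>det \<phi>\<close> and the nullity of tile boundaries.\<close>

lemma volume_ratio:
  "\<exists>c\<ge>1. \<forall>M T T'. proto_copy T \<longrightarrow> proto_copy T' \<longrightarrow> measure lebesgue ((\<phi> ^^ M) ` (\<phi> ^^ k) ` supp T) \<le> c * vol M T'"
proof -
  obtain r D where rD: "r > 0" "D > 0" "\<And>T. proto_copy T \<Longrightarrow> \<exists>x. ball x r \<subseteq> supp T \<and> supp T \<subseteq> ball x D"
    using proto_copy_radii by metis
  define K where "K = (\<phi> ^^ k) ` cball (0 :: real ^ 'n) D"
  have K: "compact K" unfolding K_def by (intro compact_pow compact_cball)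
  then obtain F where F: "finite F" "K \<subseteq> (\<Union>x\<in>F. ball x r)"
    using rD(1) unfolding compact_eq_totally_bounded by meson
  have ball: "(+) x ` ball 0 r = ball x r" for x :: "real ^ 'n"
    using ball_translation[of x 0 r] by simp
  have cov: "K \<subseteq> (\<Union>x\<in>F. (+) x ` ball 0 r)" using F(2) unfolding ball .
  have lm: "(\<phi> ^^ M) ` K \<in> lmeasurable" "(\<phi> ^^ M) ` ball 0 r \<in> lmeasurable" for M
  proof -
    show "(\<phi> ^^ M) ` K \<in> lmeasurable" by (intro lmeasurable_compact compact_pow K)
    have "bounded ((\<phi> ^^ M) ` ball 0 r)"
      by (rule bounded_linear_image[OF bounded_ball]) (use lin_pow linear_conv_bounded_linear in blast)
    then show "(\<phi> ^^ M) ` ball 0 r \<in> lmeasurable" by (intro lmeasurable_open open_pow open_ball)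
  qed
  \<comment> \<open>Adding 1 to the number of pieces makes the constant at least 1, hence
    \<open>1 - 1 / c\<close> nonnegative in \<open>shallow_volume\<close>.\<close>
  have "measure lebesgue ((\<phi> ^^ M) ` (\<phi> ^^ k) ` supp T) \<le> (real (card F) + 1) * vol M T'"
    if T: "proto_copy T" "proto_copy T'" for M T T'
  proof -
    obtain x where x: "supp T \<subseteq> ball x D" using rD(3)[OF T(1)] by blast
    obtain x' where x': "ball x' r \<subseteq> supp T'" using rD(3)[OF T(2)] by blast
    have "supp T \<subseteq> (+) x ` cball 0 D"
      using subset_trans[OF x ball_subset_cball] cball_translation[of x 0 D] by simp
    then have "(\<phi> ^^ M) ` (\<phi> ^^ k) ` supp T \<subseteq> (\<phi> ^^ M) ` (\<phi> ^^ k) ` (+) x ` cball 0 D" by (intro image_mono)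
    also have "\<dots> = (+) ((\<phi> ^^ M) ((\<phi> ^^ k) x)) ` (\<phi> ^^ M) ` K" by (simp only: pow_translation K_def)
    finally have "measure lebesgue ((\<phi> ^^ M) ` (\<phi> ^^ k) ` supp T)
        \<le> measure lebesgue ((+) ((\<phi> ^^ M) ((\<phi> ^^ k) x)) ` (\<phi> ^^ M) ` K)"
    proof (rule measure_mono_fmeasurable)
      have "(\<phi> ^^ M) ` (\<phi> ^^ k) ` supp T = (\<phi> ^^ (M + k)) ` supp T" by (simp add: funpow_add image_comp)
      then show "(\<phi> ^^ M) ` (\<phi> ^^ k) ` supp T \<in> sets lebesgue"
        using pow_supp_lmeasurable(1)[OF T(1), of "M + k"] by auto
    qed (intro measurable_translation lm)
    also have "\<dots> = measure lebesgue ((\<phi> ^^ M) ` K)" by (rule measure_translation)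
    also have "\<dots> \<le> real (card F) * measure lebesgue ((\<phi> ^^ M) ` ball 0 r)"
      by (rule measure_open_translates_le[OF lin_pow F(1) cov lm])
    also have "\<dots> \<le> (real (card F) + 1) * measure lebesgue ((\<phi> ^^ M) ` ball 0 r)"
      by (intro mult_right_mono) auto
    also have "measure lebesgue ((\<phi> ^^ M) ` ball 0 r) = measure lebesgue ((\<phi> ^^ M) ` ball x' r)"
      unfolding ball[of x', symmetric] pow_translation by (rule measure_translation[symmetric])
    also have "(real (card F) + 1) * \<dots> \<le> (real (card F) + 1) * vol M T'"
    proof (intro mult_left_mono)
      have "ball x' r \<subseteq> interior (supp T')" using x' by (simp add: interior_maximal)
      moreover have "(\<phi> ^^ M) ` ball x' r \<in> lmeasurable"
        unfolding ball[of x', symmetric] pow_translation by (intro measurable_translation lm)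
      ultimately show "measure lebesgue ((\<phi> ^^ M) ` ball x' r) \<le> vol M T'"
        unfolding vol_def by (intro measure_mono_fmeasurable image_mono fmeasurableD pow_supp_lmeasurable(2) T)
    qed auto
    finally show ?thesis .
  qed
  then show ?thesis by (intro exI[of _ "real (card F) + 1"]) auto
qed

lemma shallow_patch:
  assumes "proto_copy T"
  shows "shallow T \<in> patches_over \<A>" "Q \<in> shallow T \<Longrightarrow> proto_copy Q"
  using infl_tile(1)[OF assms, of stage] pairwise_subset
  unfolding patches_over_iff shallow_def nonoverlapping_def by blast+

text \<open>A single deep subtile takes at least the fraction \<open>1 / c\<close> of the volume.
  The same \<open>c\<close> serves all inflation levels \<open>M\<close>, and this uniformity is
  what allows iteration.\<close>

lemma shallow_volume:
  "\<exists>\<theta>\<ge>0. \<theta> < 1 \<and> (\<forall>M T. proto_copy T \<longrightarrow> (\<Sum>Q\<in>shallow T. vol M Q) \<le> \<theta> * vol (M + stage) T)"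
proof -
  obtain c where c: "c \<ge> 1" "\<And>M T T'. proto_copy T \<Longrightarrow> proto_copy T' \<Longrightarrow>
      measure lebesgue ((\<phi> ^^ M) ` (\<phi> ^^ stage) ` supp T) \<le> c * vol M T'"
    using volume_ratio[of stage] by blast
  have "(\<Sum>Q\<in>shallow T. vol M Q) \<le> (1 - 1 / c) * vol (M + stage) T" if T: "proto_copy T" for M T
  proof -
    obtain Q0 where Q0: "Q0 \<in> infl stage {T}" "Q0 \<in> deep T" using deep_nonempty[OF T] by blast
    note pat = infl_tile(1)[OF T, of stage]
    have fin: "finite (infl stage {T})" using pat unfolding patches_over_iff by blast
    have pow: "(\<phi> ^^ (M + stage)) ` S = (\<phi> ^^ M) ` (\<phi> ^^ stage) ` S" for S
      by (simp add: funpow_add image_comp)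
    have "vol M Q0 + (\<Sum>Q\<in>shallow T. vol M Q) = (\<Sum>Q\<in>insert Q0 (shallow T). vol M Q)"
      using fin Q0(2) by (subst sum.insert) (auto simp: shallow_def)
    also have "\<dots> \<le> (\<Sum>Q\<in>infl stage {T}. vol M Q)"
      using fin Q0(1) by (intro sum_mono2) (auto simp: shallow_def vol_def)
    also have "\<dots> \<le> vol (M + stage) T"
      unfolding vol_def[of "M + stage"]
    proof (rule sum_vol_le[OF pat pow_supp_lmeasurable(2)[OF T]])
      fix Q assume "Q \<in> infl stage {T}"
      from interior_mono[OF infl_tileD(2)[OF T this]]
      show "(\<phi> ^^ M) ` interior (supp Q) \<subseteq> (\<phi> ^^ (M + stage)) ` interior (supp T)"
        unfolding interior_pow pow by (rule image_mono)
    qed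
    finally have "vol M Q0 + (\<Sum>Q\<in>shallow T. vol M Q) \<le> vol (M + stage) T" .
    moreover have "vol (M + stage) T \<le> c * vol M Q0"
    proof -
      have "vol (M + stage) T \<le> measure lebesgue ((\<phi> ^^ (M + stage)) ` supp T)"
        unfolding vol_def
        by (intro measure_mono_fmeasurable image_mono interior_subset fmeasurableD pow_supp_lmeasurable T)
      also have "\<dots> \<le> c * vol M Q0"
        unfolding pow by (rule c(2)[OF T infl_tileD(1)[OF T Q0(1)]])
      finally show ?thesis .
    qed
    then have "vol (M + stage) T / c \<le> vol M Q0" using c(1) by (simp add: field_simps)
    ultimately show ?thesis by (simp add: field_simps)
  qed
  then show ?thesis using c(1) by (intro exI[of _ "1 - 1 / c"]) auto
qed

lemma region_measure:
  "\<exists>\<kappa>\<ge>0. \<exists>\<theta>\<ge>0. \<theta> < 1 \<and> (\<forall>K k T. proto_copy T \<longrightarrow> region K k T \<in> lmeasurable \<and>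
     measure lebesgue (region K k T) \<le> \<kappa> * \<theta> ^ k * vol (K + stage * k) T)"
proof -
  \<comment> \<open>The constant pays, once and at stage 0, for passing from the closed tile to its
    interior.\<close>
  obtain \<kappa> where \<kappa>: "\<kappa> \<ge> 1" "\<And>M T T'. proto_copy T \<Longrightarrow> proto_copy T' \<Longrightarrow>
      measure lebesgue ((\<phi> ^^ M) ` (\<phi> ^^ 0) ` supp T) \<le> \<kappa> * vol M T'"
    using volume_ratio[of 0] by blast
  obtain \<theta> where \<theta>: "\<theta> \<ge> 0" "\<theta> < 1" "\<And>M T. proto_copy T \<Longrightarrow> (\<Sum>Q\<in>shallow T. vol M Q) \<le> \<theta> * vol (M + stage) T"
    using shallow_volume by blast
  have "region K k T \<in> lmeasurable \<and>
     measure lebesgue (region K k T) \<le> \<kappa> * \<theta> ^ k * vol (K + stage * k) T" if "proto_copy T" for K k T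
    using that
  proof (induction k arbitrary: T)
    case 0
    then show ?case using \<kappa>(2)[OF 0 0, of K] pow_supp_lmeasurable(1)[OF 0] by simp
  next
    case (Suc k)
    have fin: "finite (shallow T)" using shallow_patch(1)[OF Suc.prems] unfolding patches_over_iff by blast
    note IH = Suc.IH[OF shallow_patch(2)[OF Suc.prems]]
    have lm: "region K (Suc k) T \<in> lmeasurable"
      using fin IH by (auto simp only: region.simps intro!: fmeasurable.finite_UN)
    have "measure lebesgue (region K (Suc k) T) \<le> (\<Sum>Q\<in>shallow T. measure lebesgue (region K k Q))"
      unfolding region.simps using fin IH fmeasurableD by (intro measure_UNION_le) blast+
    also have "\<dots> \<le> (\<Sum>Q\<in>shallow T. \<kappa> * \<theta> ^ k * vol (K + stage * k) Q)"
      using IH by (intro sum_mono) blast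
    also have "\<dots> = \<kappa> * \<theta> ^ k * (\<Sum>Q\<in>shallow T. vol (K + stage * k) Q)" by (simp add: sum_distrib_left)
    also have "\<dots> \<le> \<kappa> * \<theta> ^ k * (\<theta> * vol (K + stage * k + stage) T)"
      using \<kappa> \<theta> Suc.prems by (intro mult_left_mono mult_nonneg_nonneg) auto
    finally show ?case using lm by (simp add: algebra_simps)
  qed
  then show ?thesis using \<kappa>(1) \<theta>(1,2)
    by (intro exI[of _ \<kappa>] conjI exI[of _ \<theta>]) auto
qed

text \<open>Such a point falls into a deep tile at some stage. At least \<open>K\<close> inflations
  follow, and they stretch the margin 1 around that tile to \<open>R\<close>.\<close>

lemma outside_region:
  assumes R: "R > 0" and K: "period dvd K" "\<And>n x. K \<le> n \<Longrightarrow> R * norm x \<le> norm ((\<phi> ^^ n) x)"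
    and "proto_copy T" "y \<in> (\<phi> ^^ (K + stage * k)) ` supp T" "y \<notin> region K k T"
  shows "\<exists>D c n. final D \<and> period dvd n \<and> 1 \<le> n \<and> infl n {tile_shift c D} \<subseteq> infl (K + stage * k) {T} \<and>
    ball y R \<subseteq> (\<phi> ^^ n) ` supp (tile_shift c D)"
  using assms(4-6)
proof (induction k arbitrary: T)
  case 0
  then show ?case by simp
next
  case (Suc k)
  let ?L = "K + stage * k"
  have L: "K + stage * Suc k = ?L + stage" by simp
  have "y \<in> (\<phi> ^^ ?L) ` (\<phi> ^^ stage) ` supp T" using Suc.prems(2) unfolding L by (simp add: funpow_add image_comp)
  then have "y \<in> (\<phi> ^^ ?L) ` set_supp (infl stage {T})" unfolding infl_tile(2)[OF Suc.prems(1)] .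
  then obtain Q where Q: "Q \<in> infl stage {T}" "y \<in> (\<phi> ^^ ?L) ` supp Q" unfolding set_supp_def by blast
  show ?case
  proof (cases "Q \<in> deep T")
    case False
    then have Qs: "Q \<in> shallow T" using Q(1) by (simp add: shallow_def)
    then have "y \<notin> region K k Q" using Suc.prems(3) by auto
    from Suc.IH[OF shallow_patch(2)[OF Suc.prems(1) Qs] Q(2) this]
    show ?thesis unfolding L using infl_trans[OF Q(1), of ?L] by (meson subset_trans)
  next
    case True
    then obtain D c where D: "final D" "tile_shift c D \<in> infl period {T}" "Q \<in> infl depth {tile_shift c D}"
      "(\<Union>y\<in>supp Q. ball y 1) \<subseteq> (\<phi> ^^ depth) ` supp (tile_shift c D)"
      unfolding deep_def by blast
    \<comment> \<open>The final tile sits \<open>depth\<close> levels above \<open>Q\<close>, so the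
      level of its supertile is a sum of multiples of \<open>period\<close>.\<close>
    let ?n = "?L + depth"
    have "infl ?n {tile_shift c D} \<subseteq> infl (?n + period) {T}" by (rule infl_trans[OF D(2)])
    then have "infl ?n {tile_shift c D} \<subseteq> infl (?L + stage) {T}" by (simp only: stage_def add.assoc)
    moreover have "ball y R \<subseteq> (\<phi> ^^ ?n) ` supp (tile_shift c D)"
    proof
      fix w assume w: "w \<in> ball y R"
      obtain u where u: "u \<in> supp Q" "y = (\<phi> ^^ ?L) u" using Q(2) by blast
      obtain v where v: "w = (\<phi> ^^ ?L) v" using surj_pow[of ?L] by (meson surjE)
      have "R * norm (u - v) \<le> norm (y - w)"
        using K(2)[of ?L "u - v"] unfolding u v linear_diff[OF lin_pow] by simp
      also have "\<dots> < R * 1" using w by (simp add: dist_norm)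
      finally have "norm (u - v) < 1" using R by (simp only: mult_less_cancel_left_pos)
      then have "v \<in> ball u 1" by (simp add: dist_norm)
      then have "v \<in> (\<phi> ^^ depth) ` supp (tile_shift c D)" using D(4) u(1) by blast
      then have "w \<in> (\<phi> ^^ ?L) ` (\<phi> ^^ depth) ` supp (tile_shift c D)" unfolding v by blast
      then show "w \<in> (\<phi> ^^ ?n) ` supp (tile_shift c D)" by (simp add: funpow_add image_comp)
    qed
    moreover have "period dvd ?n" "1 \<le> ?n" using K(1) depth(1,2) period_dvd_stage by auto
    ultimately show ?thesis unfolding L using D(1) by blast
  qed
qed


section \<open>How often a tiling meets bad patches\<close>

definition bad :: "('n, 'l) tile set \<Rightarrow> bool" where
  "bad P \<longleftrightarrow> (\<forall>D. final D \<longrightarrow> \<not> final_legal D P)"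

definition bad_near :: "real ^ 'n \<Rightarrow> real \<Rightarrow> ('n, 'l) tile set set" where
  "bad_near x R = {T \<in> X. \<exists>P\<subseteq>T. finite P \<and> set_supp P \<subseteq> ball x R \<and> bad P}"

lemma bad_shift: "bad P \<Longrightarrow> bad (shift g P)"
  by (simp only: bad_def final_legal_shift)

lemma openin_bad_near: "openin (tiling_topology X) (bad_near x R)"
  unfolding bad_near_def by (rule openin_patch_condition) (auto intro: bad_shift)

lemma bad_near_shift: "T \<in> bad_near x R \<Longrightarrow> shift g T \<in> bad_near (g + x) R"
proof -
  assume "T \<in> bad_near x R"
  then obtain P where P: "T \<in> X" "P \<subseteq> T" "finite P" "set_supp P \<subseteq> ball x R" "bad P"
    unfolding bad_near_def by blast
  have "set_supp (shift g P) \<subseteq> ball (g + x) R"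
    unfolding set_supp_shift ball_translation by (rule image_mono[OF P(4)])
  moreover have "shift g P \<subseteq> shift g T" using P(2) by (rule image_mono)
  ultimately show ?thesis
    unfolding bad_near_def using X_shift[OF P(1)] P(3) bad_shift[OF P(5)] by blast
qed

lemma bad_near_image: "(\<lambda>T. shift (- g) T) ` bad_near x R = bad_near (x - g) R"
proof (intro subset_antisym subsetI)
  fix T assume "T \<in> (\<lambda>T. shift (- g) T) ` bad_near x R"
  then obtain S where "S \<in> bad_near x R" "T = shift (- g) S" by blast
  then show "T \<in> bad_near (x - g) R" using bad_near_shift[of S x R "- g"] by simp
next
  fix T assume "T \<in> bad_near (x - g) R"
  then have "shift g T \<in> bad_near x R" using bad_near_shift[of T "x - g" R g] by simp
  moreover have "T = shift (- g) (shift g T)" by (simp add: shift_add)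
  ultimately show "T \<in> (\<lambda>T. shift (- g) T) ` bad_near x R" by blast
qed

text \<open>If some \<open>y\<close> in the box avoided the regions, \<open>ball (z + y) R'\<close>
  would lie in a final supertile. Points of the box are within \<open>CARD('n)\<close> of
  \<open>x\<close>, so \<open>ball y R'\<close> contains \<open>ball x R\<close>, and the bad patch
  would be final-legal. Only supertiles meeting the moved \<open>B'\<close> are kept, which later
  bounds their total volume.\<close>

lemma bad_grid_box_in_region:
  assumes T: "T \<in> X" and A: "A \<in> \<A>"
    and R: "R' > 0" "R + real CARD('n) \<le> R'"
    and K: "period dvd K" "\<And>n x. K \<le> n \<Longrightarrow> R' * norm x \<le> norm ((\<phi> ^^ n) x)"
    and N: "N = m + (K + stage * k)" and P0: "shift z {Q \<in> T. supp Q \<inter> B \<noteq> {}} \<subseteq> infl N {A}"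
    and bad: "T \<in> bad_near x R" and B: "ball x R \<subseteq> B"
    and y: "y \<in> box x (x + 1)" "y \<in> B" "y \<in> B'"
  shows "z + y \<in> (\<Union>C\<in>{C \<in> infl m {A}. (\<phi> ^^ (K + stage * k)) ` supp C \<inter> (+) z ` B' \<noteq> {}}. region K k C)"
proof (rule ccontr)
  let ?M = "K + stage * k"
  assume out: "\<not> ?thesis"
  note ptA = proto_copy_proto[OF A]
  have NM: "infl N {A} = infl ?M (infl m {A})" unfolding N by (subst add.commute) (rule infl_add)
  have "z + y \<in> set_supp (infl N {A})"
    using subsetD[OF set_supp_mono[OF P0] patch_around_covers[OF T y(2)]] .
  then have "z + y \<in> (\<phi> ^^ ?M) ` set_supp (infl m {A})"
    unfolding NM infl_patch(2)[OF infl_tile(1)[OF ptA]] .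
  then obtain C where C: "C \<in> infl m {A}" "z + y \<in> (\<phi> ^^ ?M) ` supp C" unfolding set_supp_def by blast
  have "z + y \<notin> region K k C" using out C y(3) by blast
  from outside_region[OF R(1) K infl_tileD(1)[OF ptA C(1)] C(2) this]
  obtain D c n where D: "final D" "period dvd n" "1 \<le> n" "infl n {tile_shift c D} \<subseteq> infl ?M {C}"
    "ball (z + y) R' \<subseteq> (\<phi> ^^ n) ` supp (tile_shift c D)" by metis
  have subN: "infl n {tile_shift c D} \<subseteq> infl N {A}"
    using subset_trans[OF D(4) infl_trans[OF C(1)]] unfolding N by (simp only: add.commute)
  obtain P where P: "P \<subseteq> T" "finite P" "set_supp P \<subseteq> ball x R" "bad P"
    using bad unfolding bad_near_def by blast
  have "shift z P \<subseteq> infl n {tile_shift c D}"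
  proof
    fix Q' assume "Q' \<in> shift z P"
    then obtain Q where Q: "Q \<in> P" "Q' = tile_shift z Q" by blast
    have sQ: "supp Q \<subseteq> ball x R" using P(3) Q(1) unfolding set_supp_def by blast
    have "supp Q \<noteq> {}" using proto_copy_is_tile[OF X_proto_copy[OF T]] P(1) Q(1) unfolding is_tile_def by blast
    then have "Q \<in> {Q \<in> T. supp Q \<inter> B \<noteq> {}}" using sQ B Q(1) P(1) by blast
    then have QN: "Q' \<in> infl N {A}" unfolding Q(2) using P0 by blast
    have "\<bar>(y - x) $ i\<bar> \<le> 1" for i
    proof -
      have "x $ i < y $ i" "y $ i < x $ i + 1" using y(1) by (auto simp: mem_box_cart)
      then show ?thesis by (simp add: abs_le_iff)
    qed
    then have "norm (y - x) \<le> real CARD('n) * 1" by (rule norm_le_card_cart)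
    then have "ball x R \<subseteq> ball y R'"
      using R(2) by (intro ball_subset_ball_iff[THEN iffD2]) (simp add: dist_norm norm_minus_commute)
    then have "supp Q' \<subseteq> (+) z ` ball y R'" unfolding Q(2) supp_tile_shift using sQ by blast
    then have "supp Q' \<subseteq> set_supp (infl n {tile_shift c D})"
      using D(5) unfolding ball_translation infl_tile(2)[OF final_proto_copy[OF D(1)]] by blast
    then show "Q' \<in> infl n {tile_shift c D}"
      using patch_mem[OF infl_tile(1)[OF ptA] QN subN] by blast
  qed
  then have "final_legal D (shift z P)"
    unfolding infl_tile_shift final_legal_def
    using D(2,3) shift_subset_iff[of "- (\<phi> ^^ n) c" "shift z P" "infl n {D}"]
    by (intro exI[of _ n] exI[of _ "- (\<phi> ^^ n) c"]) simp
  then show False using P(4) D(1) unfolding final_legal_shift bad_def by blast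
qed

text \<open>The unit boxes at bad grid points are disjoint and, moved by \<open>z\<close>, lie in
  the regions of the supertiles meeting the cube; their number is at most the total volume of these
  regions.\<close>

lemma card_bad_grid:
  "\<exists>\<kappa>\<ge>0. \<exists>\<theta>\<ge>0. \<theta> < 1 \<and> (\<forall>R>0. \<forall>k. \<exists>L\<ge>1. \<forall>T\<in>X.
     real (card {x \<in> grid L. T \<in> bad_near x R}) \<le> \<kappa> * \<theta> ^ k * real L ^ CARD('n))"
proof -
  obtain \<kappa> \<theta> where \<kappa>: "\<kappa> \<ge> 0" and \<theta>: "\<theta> \<ge> 0" "\<theta> < 1" and
    reg: "\<And>K k T. proto_copy T \<Longrightarrow> region K k T \<in> lmeasurable"
      "\<And>K k T. proto_copy T \<Longrightarrow> measure lebesgue (region K k T) \<le> \<kappa> * \<theta> ^ k * vol (K + stage * k) T"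
    using region_measure by blast
  have "\<exists>L\<ge>1. \<forall>T\<in>X. real (card {x \<in> grid L. T \<in> bad_near x R}) \<le> \<kappa> * 3 ^ CARD('n) * \<theta> ^ k * real L ^ CARD('n)"
    if R: "R > 0" for R k
  proof -
    let ?d = "real CARD('n)"
    define R' where "R' = R + ?d"
    have R': "R' > 0" "R + ?d \<le> R'" using R by (auto simp: R'_def add_pos_nonneg)
    obtain K0 where K0: "\<forall>n\<ge>K0. \<forall>x. norm x \<le> 1 / R' * norm ((\<phi> ^^ n) x)"
      using expansive_eventually_large[OF expansive, of "1 / R'"] R'(1) by auto
    define K where "K = period * K0"
    have "1 * K0 \<le> K" unfolding K_def using period_pos by (rule mult_right_mono) simp
    then have "norm x \<le> 1 / R' * norm ((\<phi> ^^ n) x)" if "K \<le> n" for n x using K0 that by simp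
    then have K: "period dvd K" "\<And>n x. K \<le> n \<Longrightarrow> R' * norm x \<le> norm ((\<phi> ^^ n) x)"
      using R'(1) by (auto simp: K_def field_simps)
    let ?M = "K + stage * k"
    obtain b where b: "diam_bound ?M b" by (rule ex_diam_bound)
    note b0 = diam_boundD(1)[OF b]
    obtain R0 where R0: "\<And>T A z N B. T \<in> X \<Longrightarrow> A \<in> \<A> \<Longrightarrow> cball 0 R0 \<subseteq> B \<Longrightarrow>
      shift z {Q \<in> T. supp Q \<inter> B \<noteq> {}} \<subseteq> infl N {A} \<Longrightarrow> ?M < N" using level_large[of ?M] by blast
    \<comment> \<open>The side is at least the supertile diameter bound \<open>b\<close>, so
      supertiles meeting the cube stay in one of side \<open>L + 2 * b\<close>, at most
      \<open>3 * L\<close>; this is the origin of \<open>3 ^ CARD('n)\<close>.\<close>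
    define L where "L = nat \<lceil>b\<rceil> + 1"
    have L: "L \<ge> 1" "b \<le> real L" by (auto simp: L_def) linarith
    have "real (card {x \<in> grid L. T \<in> bad_near x R}) \<le> \<kappa> * 3 ^ CARD('n) * \<theta> ^ k * real L ^ CARD('n)"
      if T: "T \<in> X" for T
    proof -
      \<comment> \<open>Large enough to force a level above \<open>?M\<close> and to contain
        \<open>ball x R\<close> for every grid point \<open>x\<close>.\<close>
      define B where "B = (cball 0 (\<bar>R0\<bar> + ?d * real L + R) :: (real ^ 'n) set)"
      define box' where "box' = (cbox (\<chi> i. 0) (\<chi> i. real L) :: (real ^ 'n) set)"
      have "0 \<le> ?d * real L" by simp
      then have "R0 \<le> \<bar>R0\<bar> + ?d * real L + R" using R by linarith
      then have "cball 0 R0 \<subseteq> B" "bounded B" unfolding B_def by (auto intro: subset_cball)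
      obtain z N A where N: "A \<in> \<A>" "shift z {Q \<in> T. supp Q \<inter> B \<noteq> {}} \<subseteq> infl N {A}"
        by (rule X_capture[OF T \<open>bounded B\<close>])
      define m where "m = N - ?M"
      have Nm: "N = m + ?M" using R0[OF T N(1) \<open>cball 0 R0 \<subseteq> B\<close> N(2)] by (simp add: m_def)
      define \<Q> where "\<Q> = {C \<in> infl m {A}. (\<phi> ^^ ?M) ` supp C \<inter> (+) z ` box' \<noteq> {}}"
      define G where "G = {x \<in> grid L. T \<in> bad_near x R}"
      define big where "big = (+) z ` (cbox (\<chi> i. - b) (\<chi> i. real L + b) :: (real ^ 'n) set)"
      have pat: "infl m {A} \<in> patches_over \<A>" by (rule infl_tile(1)[OF proto_copy_proto[OF N(1)]])
      have \<Q>: "\<Q> \<in> patches_over \<A>" "finite \<Q>" "\<And>C. C \<in> \<Q> \<Longrightarrow> proto_copy C"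
        using patches_over_subset[OF pat, of \<Q>] unfolding patches_over_iff \<Q>_def by blast+
      have finG: "finite G" unfolding G_def by (rule finite_subset[OF _ finite_grid[of L]]) blast
      have inB: "y \<in> B" if "y \<in> box'" for y
      proof -
        have "norm y \<le> ?d * real L"
          using that by (intro norm_le_card_cart) (auto simp: box'_def mem_box_cart)
        then show ?thesis using R by (simp add: B_def)
      qed
      have cover: "(+) z ` box x (x + 1) \<subseteq> (\<Union>C\<in>\<Q>. region K k C)" if x: "x \<in> G" for x
      proof (rule image_subsetI)
        fix y assume y: "y \<in> box x (x + 1)"
        have xg: "x \<in> grid L" and xb: "T \<in> bad_near x R" using x by (auto simp: G_def)
        have x01: "0 \<le> x $ i" "x $ i + 1 \<le> real L" for i
          by (rule grid_component[OF xg, of i]; simp)+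
        have "y \<in> box'" unfolding box'_def mem_box_cart
        proof (intro allI conjI)
          fix i
          have "x $ i < y $ i" "y $ i < x $ i + 1" using y by (auto simp: mem_box_cart)
          then show "(\<chi> i. 0) $ i \<le> y $ i" "y $ i \<le> (\<chi> i. real L) $ i"
            using x01[of i] by auto
        qed
        have xB: "ball x R \<subseteq> B"
        proof
          fix u assume u: "u \<in> ball x R"
          have "\<bar>x $ i\<bar> \<le> real L" for i using x01[of i] by simp
          then have "norm x \<le> ?d * real L" by (rule norm_le_card_cart)
          then show "u \<in> B" using u norm_triangle_sub[of u x] by (simp add: B_def dist_norm norm_minus_commute)
        qed
        show "z + y \<in> (\<Union>C\<in>\<Q>. region K k C)"
          unfolding \<Q>_def
          by (rule bad_grid_box_in_region[OF T N(1) R' K Nm N(2) xb xB y inB[OF \<open>y \<in> box'\<close>] \<open>y \<in> box'\<close>])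
      qed
      have lmbox: "(+) z ` box x (x + 1) \<in> lmeasurable" for x :: "real ^ 'n"
        by (intro measurable_translation lmeasurable_box)
      have disj: "pairwise (\<lambda>x y. disjnt ((+) z ` box x (x + 1)) ((+) z ` box y (y + 1))) G"
        unfolding pairwise_def disjnt_def
      proof (intro ballI impI)
        fix x y assume "x \<in> G" "y \<in> G" "x \<noteq> y"
        then have "box x (x + 1) \<inter> box y (y + 1) = {}"
          by (intro grid_boxes_disjoint[of x L y]) (auto simp: G_def)
        then show "(+) z ` box x (x + 1) \<inter> (+) z ` box y (y + 1) = {}" by auto
      qed
      have "real (card G) = (\<Sum>x\<in>G. measure lebesgue ((+) z ` box x (x + 1)))"
        by (simp add: measure_translation measure_unit_box_cart)
      also have "\<dots> = measure lebesgue (\<Union>x\<in>G. (+) z ` box x (x + 1))"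
        using lmbox disj finG by (intro measure_UNION'[symmetric]) auto
      also have "\<dots> \<le> measure lebesgue (\<Union>C\<in>\<Q>. region K k C)"
        using cover finG lmbox \<Q> reg(1)
        by (intro measure_mono_fmeasurable fmeasurable.finite_UN sets.finite_UN) (auto intro: fmeasurableD)
      also have "\<dots> \<le> (\<Sum>C\<in>\<Q>. measure lebesgue (region K k C))"
        using \<Q>(2) reg(1)[OF \<Q>(3)] by (intro measure_UNION_le) auto
      also have "\<dots> \<le> (\<Sum>C\<in>\<Q>. \<kappa> * \<theta> ^ k * vol ?M C)"
        using reg(2)[OF \<Q>(3)] by (intro sum_mono) blast
      also have "\<dots> = \<kappa> * \<theta> ^ k * (\<Sum>C\<in>\<Q>. vol ?M C)" by (simp add: sum_distrib_left)
      also have "\<dots> \<le> \<kappa> * \<theta> ^ k * measure lebesgue big"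
      proof (intro mult_left_mono sum_vol_le[OF \<Q>(1)])
        show "big \<in> lmeasurable" unfolding big_def by (intro measurable_translation lmeasurable_cbox)
        fix C assume C: "C \<in> \<Q>"
        show "(\<phi> ^^ ?M) ` interior (supp C) \<subseteq> big"
        proof
          fix u assume "u \<in> (\<phi> ^^ ?M) ` interior (supp C)"
          then have u: "u \<in> (\<phi> ^^ ?M) ` supp C" using interior_subset by blast
          have "(\<phi> ^^ ?M) ` supp C \<inter> (+) z ` box' \<noteq> {}" using C unfolding \<Q>_def by (elim CollectE conjE)
          then obtain q where q: "q \<in> (\<phi> ^^ ?M) ` supp C \<inter> (+) z ` box'" by (rule ex_in_conv[THEN iffD2, THEN exE])
          obtain w where w: "q = z + w" "w \<in> box'" using IntD2[OF q] by (rule imageE)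
          note w = w(2) IntD1[OF q, unfolded w(1)]
          have "dist u (z + w) \<le> b" by (rule diam_boundD(2)[OF b \<Q>(3)[OF C] u w(2)])
          then have "\<bar>(u - (z + w)) $ i\<bar> \<le> b" for i
            using component_le_norm_cart[of "u - (z + w)" i] by (simp add: dist_norm)
          then have "\<bar>u $ i - z $ i - w $ i\<bar> \<le> b" "0 \<le> w $ i" "w $ i \<le> real L" for i
            using w(1) by (auto simp: box'_def mem_box_cart diff_diff_eq)
          then have "- b \<le> u $ i - z $ i \<and> u $ i - z $ i \<le> real L + b" for i
            by (smt (verit))
          then have "u - z \<in> cbox (\<chi> i. - b) (\<chi> i. real L + b)" by (simp add: mem_box_cart)
          then have "z + (u - z) \<in> big" unfolding big_def by (rule imageI)
          then show "u \<in> big" by simp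
        qed
      qed (use \<kappa> \<theta> in auto)
      also have "measure lebesgue big = (real L + b - - b) ^ CARD('n)"
        unfolding big_def using b0 by (intro measure_cube_cart) simp
      also have "\<kappa> * \<theta> ^ k * \<dots> \<le> \<kappa> * \<theta> ^ k * (3 * real L) ^ CARD('n)"
        using L b0 \<kappa> \<theta> by (intro mult_left_mono power_mono) auto
      finally show ?thesis by (simp add: G_def power_mult_distrib algebra_simps)
    qed
    then show ?thesis using L(1) by blast
  qed
  then show ?thesis using \<kappa> \<theta> by (intro exI[of _ "\<kappa> * 3 ^ CARD('n)"] conjI exI[of _ \<theta>]) auto
qed

section \<open>Invariant measures\<close>

text \<open>Averaging over a finite grid takes the place of an ergodic theorem: all
  \<open>bad_near x R\<close> have the same measure, so the pointwise count of
  \<open>card_bad_grid\<close> bounds it by a null sequence in \<open>k\<close>.\<close>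

lemma bad_near_null:
  assumes "prob_space \<mu>" and sets: "sets \<mu> = sets (tiling_borel X)" and inv: "translation_invariant \<mu>"
    and R: "R > 0"
  shows "measure \<mu> (bad_near 0 R) = 0"
proof -
  interpret prob_space \<mu> by fact
  have space: "space \<mu> = X"
    using sets_eq_imp_space_eq[OF sets] by (simp add: tiling_borel_def space_measure_of_conv)
  have "{U. openin (tiling_topology X) U} \<subseteq> Pow X"
    using openin_subset by (metis Pow_iff mem_Collect_eq subsetI topspace_tiling_topology)
  then have "bad_near x R \<in> sets (tiling_borel X)" for x
    unfolding tiling_borel_def by (subst sets_measure_of) (auto intro: sigma_sets.Basic openin_bad_near)
  then have meas: "bad_near x R \<in> sets \<mu>" for x by (simp only: sets)
  define \<delta> where "\<delta> = measure \<mu> (bad_near 0 R)"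
  have \<delta>: "measure \<mu> (bad_near x R) = \<delta>" for x
  proof -
    have "emeasure \<mu> ((\<lambda>T. shift (- (- x)) T) ` bad_near 0 R) = emeasure \<mu> (bad_near 0 R)"
      using inv meas unfolding translation_invariant_def by blast
    then have "emeasure \<mu> (bad_near (0 - (- x)) R) = emeasure \<mu> (bad_near 0 R)"
      unfolding bad_near_image .
    then show ?thesis by (simp add: \<delta>_def measure_def)
  qed
  obtain \<kappa> \<theta> where \<kappa>: "\<kappa> \<ge> 0" and \<theta>: "\<theta> \<ge> 0" "\<theta> < 1" and
    cnt: "\<And>k. \<exists>L\<ge>1. \<forall>T\<in>X. real (card {x \<in> grid L. T \<in> bad_near x R}) \<le> \<kappa> * \<theta> ^ k * real L ^ CARD('n)"
    using card_bad_grid R by blast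
  have "\<delta> \<le> \<kappa> * \<theta> ^ k" for k
  proof -
    obtain L where L: "L \<ge> 1" "\<And>T. T \<in> X \<Longrightarrow> real (card {x \<in> grid L. T \<in> bad_near x R}) \<le> \<kappa> * \<theta> ^ k * real L ^ CARD('n)"
      using cnt[of k] by blast
    let ?G = "grid L :: (real ^ 'n) set"
    have int: "integrable \<mu> (indicator (bad_near x R) :: _ \<Rightarrow> real)" for x
      using meas by (simp add: integrable_real_indicator emeasure_finite less_top[symmetric])
    have "real L ^ CARD('n) * \<delta> = (\<Sum>x\<in>?G. \<delta>)" by (simp add: card_grid)
    also have "\<dots> = (\<Sum>x\<in>?G. expectation (indicator (bad_near x R)))"
      using meas by (simp add: \<delta>)
    also have "\<dots> = expectation (\<lambda>T. \<Sum>x\<in>?G. indicator (bad_near x R) T)"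
      using int by (intro Bochner_Integration.integral_sum[symmetric])
    also have "\<dots> \<le> \<kappa> * \<theta> ^ k * real L ^ CARD('n)"
    proof (rule integral_le_const)
      show "integrable \<mu> (\<lambda>T. \<Sum>x\<in>?G. indicator (bad_near x R) T :: real)"
        using int by (intro Bochner_Integration.integrable_sum)
      have "(\<Sum>x\<in>?G. indicator (bad_near x R) T :: real) \<le> \<kappa> * \<theta> ^ k * real L ^ CARD('n)"
        if "T \<in> X" for T
      proof -
        have "(\<Sum>x\<in>?G. indicator (bad_near x R) T :: real) = (\<Sum>x\<in>?G. if T \<in> bad_near x R then 1 else 0)"
          by (intro sum.cong) (auto simp: indicator_def)
        also have "\<dots> = (\<Sum>x\<in>{x \<in> ?G. T \<in> bad_near x R}. 1)"
          by (rule sum.inter_filter[OF finite_grid, symmetric])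
        finally have "(\<Sum>x\<in>?G. indicator (bad_near x R) T :: real) = real (card {x \<in> ?G. T \<in> bad_near x R})"
          by simp
        then show ?thesis using L(2)[OF that] by simp
      qed
      then show "AE T in \<mu>. (\<Sum>x\<in>?G. indicator (bad_near x R) T :: real) \<le> \<kappa> * \<theta> ^ k * real L ^ CARD('n)"
        unfolding space[symmetric] by (rule AE_I2)
    qed
    finally have "real L ^ CARD('n) * \<delta> \<le> real L ^ CARD('n) * (\<kappa> * \<theta> ^ k)" by (simp add: mult.commute)
    moreover have "real L ^ CARD('n) > 0" using L(1) by simp
    ultimately show ?thesis by (simp only: mult_le_cancel_left_pos)
  qed
  moreover have "(\<lambda>k. \<kappa> * \<theta> ^ k) \<longlonglongrightarrow> 0"
    using \<theta> by (intro tendsto_mult_right_zero LIMSEQ_power_zero) auto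
  ultimately have "\<delta> \<le> 0" by (intro LIMSEQ_le_const) auto
  then show ?thesis using measure_nonneg[of \<mu> "bad_near 0 R"] by (simp add: \<delta>_def)
qed

text \<open>A tiling outside every component has, for each final \<open>D\<close>, a patch that is
  not \<open>final_legal\<close> for \<open>D\<close>. The finite union of these patches is bad,
  since \<open>final_legal\<close> passes to subsets. The right-hand side, a countable union of open
  sets, also yields measurability.\<close>

lemma X_minus_components: "X - \<Union>{Y. minimal_component X Y} = (\<Union>i. bad_near 0 (real (Suc i)))"
proof (intro subset_antisym subsetI)
  fix T assume "T \<in> X - \<Union>{Y. minimal_component X Y}"
  then have T: "T \<in> X" "\<And>D. final D \<Longrightarrow> T \<notin> component D" unfolding minimal_component_iff by blast+
  have "\<exists>P. P \<subseteq> T \<and> finite P \<and> \<not> final_legal D P" if "final D" for D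
    using T(2)[OF that] T(1) unfolding component_def by blast
  then obtain p where p: "\<And>D. final D \<Longrightarrow> p D \<subseteq> T \<and> finite (p D) \<and> \<not> final_legal D (p D)" by metis
  define P where "P = (\<Union>D\<in>{D. final D}. p D)"
  have fin: "finite {D. final D}"
    by (rule finite_subset[OF _ finite_\<A>]) (unfold final_def, blast)
  have P: "P \<subseteq> T" "finite P" using p fin unfolding P_def by blast+
  have "bad P" unfolding bad_def
  proof (intro allI impI notI)
    fix D assume D: "final D" "final_legal D P"
    have "p D \<subseteq> P" using D(1) unfolding P_def by blast
    from final_legal_subset[OF D(2) this] show False using p[OF D(1)] by blast
  qed
  have "bounded (set_supp P)"
    unfolding set_supp_def
  proof (intro bounded_UN ballI P(2))
    fix Q assume "Q \<in> P"
    then have "is_tile Q" using P(1) X_proto_copy[OF T(1)] proto_copy_is_tile by blast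
    then show "bounded (supp Q)" unfolding is_tile_def using compact_imp_bounded by blast
  qed
  then obtain r where "set_supp P \<subseteq> ball 0 r" using bounded_subset_ballD by blast
  moreover obtain i where "r \<le> real i" using real_arch_simple by blast
  then have "ball 0 r \<subseteq> ball (0 :: real ^ 'n) (real (Suc i))" by (intro subset_ball) simp
  ultimately have "T \<in> bad_near 0 (real (Suc i))"
    unfolding bad_near_def using T(1) P \<open>bad P\<close> by blast
  then show "T \<in> (\<Union>i. bad_near 0 (real (Suc i)))" by blast
next
  fix T assume "T \<in> (\<Union>i. bad_near 0 (real (Suc i)))"
  then obtain P where P: "T \<in> X" "P \<subseteq> T" "finite P" "bad P" unfolding bad_near_def by blast
  have "T \<notin> component D" if "final D" for D
    using P that unfolding component_def bad_def by blast
  then show "T \<in> X - \<Union>{Y. minimal_component X Y}" using P(1) unfolding minimal_component_iff by blast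
qed

lemma components_full_measure:
  assumes "prob_space \<mu>" and sets: "sets \<mu> = sets (tiling_borel X)" and inv: "translation_invariant \<mu>"
  shows "\<Union>{Y. minimal_component X Y} \<in> sets \<mu> \<and> emeasure \<mu> (\<Union>{Y. minimal_component X Y}) = 1"
proof -
  interpret prob_space \<mu> by fact
  let ?V = "\<Union>{Y. minimal_component X Y}"
  have space: "space \<mu> = X"
    using sets_eq_imp_space_eq[OF sets] by (simp add: tiling_borel_def space_measure_of_conv)
  have Pow: "{U. openin (tiling_topology X) U} \<subseteq> Pow X"
    using openin_subset by (metis Pow_iff mem_Collect_eq subsetI topspace_tiling_topology)
  have VX: "?V \<subseteq> X"
    unfolding minimal_component_iff component_def by blast
  have meas: "bad_near 0 (real (Suc i)) \<in> sets \<mu>" for i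
    unfolding sets tiling_borel_def sets_measure_of[OF Pow]
    by (intro sigma_sets.Basic CollectI openin_bad_near)
  then have "bad_near 0 (real (Suc i)) \<in> null_sets \<mu>" for i
    using bad_near_null[OF assms, of "real (Suc i)"]
    by (intro null_setsI) (simp_all add: emeasure_eq_measure)
  then have null: "X - ?V \<in> null_sets \<mu>"
    unfolding X_minus_components by (intro null_sets_UN)
  have eq: "?V = space \<mu> - (X - ?V)" using VX space by blast
  have "?V \<in> sets \<mu>" by (subst eq) (intro sets.compl_sets null_setsD2[OF null])
  moreover have "emeasure \<mu> ?V = 1"
    by (subst eq) (simp only: emeasure_Diff_null_set[OF null sets.top] emeasure_space_1)
  ultimately show ?thesis by blast
qed

end

theorem theoremA:
  fixes \<phi> :: "real ^ 'n \<Rightarrow> real ^ 'n::finite"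
    and \<A> :: "('n, 'l::finite) tile set"
    and \<omega> :: "('n, 'l) tile \<Rightarrow> ('n, 'l) tile set"
    and \<mu> :: "('n, 'l) tile set measure"
  assumes "tile_substitution \<phi> \<A> \<omega>"
    and "admissible \<phi> \<A> \<omega>"
    and "FPC (tiling_space \<phi> \<A> \<omega>)"
    and "prob_space \<mu>"
    and "sets \<mu> = sets (tiling_borel (tiling_space \<phi> \<A> \<omega>))"
    and "translation_invariant \<mu>"
    and "translation_ergodic \<mu>"
  shows "\<Union>{Y. minimal_component (tiling_space \<phi> \<A> \<omega>) Y} \<in> sets \<mu> \<and>
         emeasure \<mu> (\<Union>{Y. minimal_component (tiling_space \<phi> \<A> \<omega>) Y}) = 1"
proof -
  interpret tile_subst \<phi> \<A> \<omega> using assms(1) by unfold_locales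
  show ?thesis by (rule components_full_measure[OF assms(4-6)])
qed

end
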